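(* Let $(S,g_0)$ be a compact Riemannian manifold endowed with a non-trivial periodic Killing vector field $Y$ of constant length, and let $\omega$ be a one-form on $S$ such that $\omega(Y)<0$ everywhere and $L_Y\omega=0$. Then there exist at least two closed (non-trivial) geodesics of the Kropina metric $K(v)=-\frac{g_0(v,v)}{2\omega(v)}$.
   Context: $S$ is a connected smooth manifold (without boundary) of dimension at least $2$; $g_0,\omega,Y$ are smooth. A Killing vector field is periodic if all its orbits are closed; constant length means $g_0(Y,Y)$ is constant. $L_Y$ is the Lie derivative. The Kropina metric $K(v)=-\frac{g_0(v,v)}{2\omega(v)}$ is defined (and positive) on $\mathcal A=\{v\in TS:\ -\omega(v)>0\}$. $\Omega(\mathcal A)$ is the set of continuous, piecewise smooth curves $\gamma:[0,1]\to S$ with $\gamma(0)=\gamma(1)$ whose left and right derivatives belong to $\mathcal A$ for every $s\in[0,1]$ (at $s=0$ and $s=1$ understood periodically). A closed geodesic of $(S,K)$ is a critical point of the energy $E(\gamma)=\frac12\int_0^1K^2(\dot\gamma)\,ds$ on $\Omega(\mathcal A)$. Two closed geodesics that differ only by a reparametrization are not counted as different. *)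

theory Defs
  imports "HOL-Analysis.Analysis"
begin

section \<open>Smooth maps between Euclidean spaces\<close>

text \<open>The definitions below are meant for open sets: \<^term>\<open>at x\<close> is the unrestricted filter.\<close>

primrec Ck_on :: "nat \<Rightarrow> ('x::euclidean_space \<Rightarrow> 'y::real_normed_vector) \<Rightarrow> 'x set \<Rightarrow> bool" where
  "Ck_on 0 f S \<longleftrightarrow> continuous_on S f"
| "Ck_on (Suc k) f S \<longleftrightarrow>
     (\<forall>x\<in>S. f differentiable (at x)) \<and> (\<forall>v. Ck_on k (\<lambda>x. frechet_derivative f (at x) v) S)"

definition smooth_on :: "'x set \<Rightarrow> ('x::euclidean_space \<Rightarrow> 'y::real_normed_vector) \<Rightarrow> bool" where
  "smooth_on S f \<longleftrightarrow> (\<forall>k. Ck_on k f S)"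


section \<open>Smooth manifolds\<close>

text \<open>A chart is a coordinate domain together with a coordinate map, whose values outside the
  domain are irrelevant. The dimension of the manifold is that of the model space \<open>'e\<close>.\<close>

type_synonym ('a, 'e) chart = "'a set \<times> ('a \<Rightarrow> 'e)"

definition is_chart :: "'a topology \<Rightarrow> ('a, 'e::euclidean_space) chart \<Rightarrow> bool" where
  "is_chart X c \<longleftrightarrow> openin X (fst c) \<and> open (snd c ` fst c) \<and>
     homeomorphic_map (subtopology X (fst c)) (top_of_set (snd c ` fst c)) (snd c)"

definition chart_inv :: "('a, 'e) chart \<Rightarrow> 'e \<Rightarrow> 'a" where
  "chart_inv c = inv_into (fst c) (snd c)"

definition transition :: "('a, 'e) chart \<Rightarrow> ('a, 'e) chart \<Rightarrow> 'e \<Rightarrow> 'e" where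
  "transition c d = snd d \<circ> chart_inv c"

definition smooth_atlas :: "'a topology \<Rightarrow> ('a, 'e::euclidean_space) chart set \<Rightarrow> bool" where
  "smooth_atlas X A \<longleftrightarrow> (\<forall>c\<in>A. is_chart X c) \<and> (\<Union>c\<in>A. fst c) = topspace X \<and>
     (\<forall>c\<in>A. \<forall>d\<in>A. smooth_on (snd c ` (fst c \<inter> fst d)) (transition c d))"

definition smooth_manifold :: "'a topology \<Rightarrow> ('a, 'e::euclidean_space) chart set \<Rightarrow> bool" where
  "smooth_manifold X A \<longleftrightarrow> Hausdorff_space X \<and> second_countable X \<and> smooth_atlas X A"

definition charts_at :: "('a, 'e) chart set \<Rightarrow> 'a \<Rightarrow> ('a, 'e) chart set" where
  "charts_at A p = {c \<in> A. p \<in> fst c}"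

text \<open>Smoothness of a map from an arbitrary subset \<open>D\<close> of a Euclidean space to the manifold: near
  each point of \<open>D\<close>, the coordinate expression extends to a smooth map on an open set.\<close>

definition smooth_into ::
  "('a, 'e::euclidean_space) chart set \<Rightarrow> 'x::euclidean_space set \<Rightarrow> ('x \<Rightarrow> 'a) \<Rightarrow> bool" where
  "smooth_into A D F \<longleftrightarrow> (\<forall>x\<in>D. \<exists>c\<in>A. \<exists>W h. open W \<and> x \<in> W \<and> smooth_on W h \<and>
     (\<forall>y\<in>W \<inter> D. F y \<in> fst c \<and> snd c (F y) = h y))"


section \<open>Tangent vectors\<close>

text \<open>A tangent vector at \<open>p\<close> is the family of its coordinate vectors in all charts at \<open>p\<close>,
  which are related by the differentials of the transition maps. For charts that do not contain
  \<open>p\<close> the entry is 0, so that tangent vectors with equal coordinates are equal.\<close>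

type_synonym ('a, 'e) tvec = "('a, 'e) chart \<Rightarrow> 'e"

definition tangent_space :: "('a, 'e::euclidean_space) chart set \<Rightarrow> 'a \<Rightarrow> ('a, 'e) tvec set" where
  "tangent_space A p = {v.
     (\<forall>c\<in>charts_at A p. \<forall>d\<in>charts_at A p.
        v d = frechet_derivative (transition c d) (at (snd c p)) (v c)) \<and>
     (\<forall>c. c \<notin> charts_at A p \<longrightarrow> v c = 0)}"

definition tlin :: "real \<Rightarrow> ('a, 'e::euclidean_space) tvec \<Rightarrow> real \<Rightarrow> ('a, 'e) tvec \<Rightarrow> ('a, 'e) tvec" where
  "tlin a v b w = (\<lambda>c. a *\<^sub>R v c + b *\<^sub>R w c)"

text \<open>The tangent vector at \<open>p\<close> with coordinates \<open>u\<close> in the chart \<open>c\<close>, that is,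
  the value at \<open>p\<close> of the coordinate field \<open>\<partial>\<^sub>u\<close> of \<open>c\<close>.\<close>

definition coord_vec ::
  "('a, 'e::euclidean_space) chart set \<Rightarrow> ('a, 'e) chart \<Rightarrow> 'a \<Rightarrow> 'e \<Rightarrow> ('a, 'e) tvec" where
  "coord_vec A c p u =
     (\<lambda>d. if d \<in> charts_at A p then frechet_derivative (transition c d) (at (snd c p)) u else 0)"


section \<open>Vector fields, one-forms and Riemannian metrics\<close>

definition smooth_vector_field ::
  "'a topology \<Rightarrow> ('a, 'e::euclidean_space) chart set \<Rightarrow> ('a \<Rightarrow> ('a, 'e) tvec) \<Rightarrow> bool" where
  "smooth_vector_field X A Y \<longleftrightarrow> (\<forall>p\<in>topspace X. Y p \<in> tangent_space A p) \<and>
     (\<forall>c\<in>A. smooth_on (snd c ` fst c) (\<lambda>x. Y (chart_inv c x) c))"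

definition smooth_one_form ::
  "'a topology \<Rightarrow> ('a, 'e::euclidean_space) chart set \<Rightarrow> ('a \<Rightarrow> ('a, 'e) tvec \<Rightarrow> real) \<Rightarrow> bool" where
  "smooth_one_form X A \<omega> \<longleftrightarrow>
     (\<forall>p\<in>topspace X. \<forall>v\<in>tangent_space A p. \<forall>w\<in>tangent_space A p. \<forall>a b.
        \<omega> p (tlin a v b w) = a * \<omega> p v + b * \<omega> p w) \<and>
     (\<forall>c\<in>A. \<forall>u. smooth_on (snd c ` fst c)
        (\<lambda>x. \<omega> (chart_inv c x) (coord_vec A c (chart_inv c x) u)))"

definition riemannian_metric ::
  "'a topology \<Rightarrow> ('a, 'e::euclidean_space) chart set
     \<Rightarrow> ('a \<Rightarrow> ('a, 'e) tvec \<Rightarrow> ('a, 'e) tvec \<Rightarrow> real) \<Rightarrow> bool" where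
  "riemannian_metric X A g \<longleftrightarrow>
     (\<forall>p\<in>topspace X. \<forall>v\<in>tangent_space A p. \<forall>w\<in>tangent_space A p.
        g p v w = g p w v \<and>
        (\<forall>z\<in>tangent_space A p. \<forall>a b. g p (tlin a v b w) z = a * g p v z + b * g p w z)) \<and>
     (\<forall>p\<in>topspace X. \<forall>v\<in>tangent_space A p. v \<noteq> (\<lambda>c. 0) \<longrightarrow> g p v v > 0) \<and>
     (\<forall>c\<in>A. \<forall>u w. smooth_on (snd c ` fst c)
        (\<lambda>x. g (chart_inv c x) (coord_vec A c (chart_inv c x) u) (coord_vec A c (chart_inv c x) w)))"

text \<open>The Lie derivatives \<open>(L\<^sub>Y \<omega>)\<^sub>p\<close> and \<open>(L\<^sub>Y g)\<^sub>p\<close>, evaluated on the coordinate fields of a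
  chart \<open>c\<close> at \<open>p\<close> by
  \<open>(L\<^sub>Y \<omega>)(Z) = Y(\<omega>(Z)) - \<omega>([Y,Z])\<close> and
  \<open>(L\<^sub>Y g)(Z,W) = Y(g(Z,W)) - g([Y,Z],W) - g(Z,[Y,W])\<close>;
  here \<^term>\<open>bracket_coord A Y c p u\<close> is \<open>[Y,\<partial>\<^sub>u]\<close> at \<open>p\<close>, whose coordinates in \<open>c\<close> are
  \<open>- D\<^sub>u Y\<close> because \<open>\<partial>\<^sub>u\<close> has constant coordinates.\<close>

definition bracket_coord ::
  "('a, 'e::euclidean_space) chart set \<Rightarrow> ('a \<Rightarrow> ('a, 'e) tvec) \<Rightarrow> ('a, 'e) chart \<Rightarrow> 'a \<Rightarrow> 'e \<Rightarrow> ('a, 'e) tvec"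
  where
  "bracket_coord A Y c p u =
     coord_vec A c p (- frechet_derivative (\<lambda>x. Y (chart_inv c x) c) (at (snd c p)) u)"

definition deriv_along ::
  "('a \<Rightarrow> ('a, 'e::euclidean_space) tvec) \<Rightarrow> ('a, 'e) chart \<Rightarrow> ('a \<Rightarrow> real) \<Rightarrow> 'a \<Rightarrow> real" where
  "deriv_along Y c f p = frechet_derivative (\<lambda>x. f (chart_inv c x)) (at (snd c p)) (Y p c)"

definition lie_deriv_form ::
  "('a, 'e::euclidean_space) chart set \<Rightarrow> ('a \<Rightarrow> ('a, 'e) tvec) \<Rightarrow> ('a \<Rightarrow> ('a, 'e) tvec \<Rightarrow> real)
     \<Rightarrow> ('a, 'e) chart \<Rightarrow> 'a \<Rightarrow> 'e \<Rightarrow> real" where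
  "lie_deriv_form A Y \<omega> c p u =
     deriv_along Y c (\<lambda>q. \<omega> q (coord_vec A c q u)) p - \<omega> p (bracket_coord A Y c p u)"

definition lie_deriv_metric ::
  "('a, 'e::euclidean_space) chart set \<Rightarrow> ('a \<Rightarrow> ('a, 'e) tvec)
     \<Rightarrow> ('a \<Rightarrow> ('a, 'e) tvec \<Rightarrow> ('a, 'e) tvec \<Rightarrow> real)
     \<Rightarrow> ('a, 'e) chart \<Rightarrow> 'a \<Rightarrow> 'e \<Rightarrow> 'e \<Rightarrow> real" where
  "lie_deriv_metric A Y g c p u w =
     deriv_along Y c (\<lambda>q. g q (coord_vec A c q u) (coord_vec A c q w)) p
     - g p (bracket_coord A Y c p u) (coord_vec A c p w)
     - g p (coord_vec A c p u) (bracket_coord A Y c p w)"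

definition lie_invariant_form ::
  "'a topology \<Rightarrow> ('a, 'e::euclidean_space) chart set \<Rightarrow> ('a \<Rightarrow> ('a, 'e) tvec)
     \<Rightarrow> ('a \<Rightarrow> ('a, 'e) tvec \<Rightarrow> real) \<Rightarrow> bool" where
  "lie_invariant_form X A Y \<omega> \<longleftrightarrow>
     (\<forall>p\<in>topspace X. \<forall>c\<in>charts_at A p. \<forall>u. lie_deriv_form A Y \<omega> c p u = 0)"

definition killing_field ::
  "'a topology \<Rightarrow> ('a, 'e::euclidean_space) chart set
     \<Rightarrow> ('a \<Rightarrow> ('a, 'e) tvec \<Rightarrow> ('a, 'e) tvec \<Rightarrow> real) \<Rightarrow> ('a \<Rightarrow> ('a, 'e) tvec) \<Rightarrow> bool" where
  "killing_field X A g Y \<longleftrightarrow> smooth_vector_field X A Y \<and>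
     (\<forall>p\<in>topspace X. \<forall>c\<in>charts_at A p. \<forall>u w. lie_deriv_metric A Y g c p u w = 0)"

definition integral_curve ::
  "('a, 'e::euclidean_space) chart set \<Rightarrow> ('a \<Rightarrow> ('a, 'e) tvec) \<Rightarrow> (real \<Rightarrow> 'a) \<Rightarrow> bool" where
  "integral_curve A Y \<gamma> \<longleftrightarrow> smooth_into A UNIV \<gamma> \<and>
     (\<forall>t. \<forall>c\<in>charts_at A (\<gamma> t). ((snd c \<circ> \<gamma>) has_vector_derivative Y (\<gamma> t) c) (at t))"

text \<open>Closed orbits are orbits of periodic integral curves (not topologically closed subsets);
  different orbits may have different periods.\<close>

definition periodic_field ::
  "'a topology \<Rightarrow> ('a, 'e::euclidean_space) chart set \<Rightarrow> ('a \<Rightarrow> ('a, 'e) tvec) \<Rightarrow> bool" where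
  "periodic_field X A Y \<longleftrightarrow>
     (\<forall>p\<in>topspace X. \<exists>\<gamma> T. integral_curve A Y \<gamma> \<and> \<gamma> 0 = p \<and> T > 0 \<and> (\<forall>t. \<gamma> (t + T) = \<gamma> t))"


section \<open>Closed geodesics of the Kropina metric\<close>

definition kropina ::
  "('a \<Rightarrow> ('a, 'e) tvec \<Rightarrow> ('a, 'e) tvec \<Rightarrow> real) \<Rightarrow> ('a \<Rightarrow> ('a, 'e) tvec \<Rightarrow> real)
     \<Rightarrow> 'a \<Rightarrow> ('a, 'e) tvec \<Rightarrow> real" where
  "kropina g \<omega> p v = - (g p v v / (2 * \<omega> p v))"

text \<open>The fibre over \<open>p\<close> of the domain of the Kropina metric.\<close>

definition kropina_dom ::
  "('a, 'e::euclidean_space) chart set \<Rightarrow> ('a \<Rightarrow> ('a, 'e) tvec \<Rightarrow> real) \<Rightarrow> 'a \<Rightarrow> ('a, 'e) tvec set" where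
  "kropina_dom A \<omega> p = {v \<in> tangent_space A p. - \<omega> p v > 0}"

text \<open>A loop is given by its restriction to \<open>[0,1]\<close>; \<open>periodize\<close> is its 1-periodic extension.\<close>

definition periodize :: "(real \<Rightarrow> 'a) \<Rightarrow> real \<Rightarrow> 'a" where
  "periodize \<gamma> s = \<gamma> (frac s)"

definition velocity ::
  "('a, 'e::euclidean_space) chart set \<Rightarrow> (real \<Rightarrow> 'a) \<Rightarrow> real \<Rightarrow> real filter \<Rightarrow> ('a, 'e) tvec" where
  "velocity A \<gamma> s F =
     (\<lambda>c. if c \<in> charts_at A (\<gamma> s) then vector_derivative (snd c \<circ> \<gamma>) F else 0)"

definition right_velocity ::
  "('a, 'e::euclidean_space) chart set \<Rightarrow> (real \<Rightarrow> 'a) \<Rightarrow> real \<Rightarrow> ('a, 'e) tvec" where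
  "right_velocity A \<gamma> s = velocity A (periodize \<gamma>) s (at_right s)"

definition left_velocity ::
  "('a, 'e::euclidean_space) chart set \<Rightarrow> (real \<Rightarrow> 'a) \<Rightarrow> real \<Rightarrow> ('a, 'e) tvec" where
  "left_velocity A \<gamma> s = velocity A (periodize \<gamma>) s (at_left s)"

definition partition01 :: "real set \<Rightarrow> bool" where
  "partition01 P \<longleftrightarrow> finite P \<and> {0, 1} \<subseteq> P \<and> P \<subseteq> {0..1}"

definition adjacent :: "real set \<Rightarrow> real \<Rightarrow> real \<Rightarrow> bool" where
  "adjacent P a b \<longleftrightarrow> a \<in> P \<and> b \<in> P \<and> a < b \<and> {a<..<b} \<inter> P = {}"

definition piecewise_smooth :: "('a, 'e::euclidean_space) chart set \<Rightarrow> (real \<Rightarrow> 'a) \<Rightarrow> bool" where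
  "piecewise_smooth A \<gamma> \<longleftrightarrow>
     (\<exists>P. partition01 P \<and> (\<forall>a b. adjacent P a b \<longrightarrow> smooth_into A {a..b} \<gamma>))"

definition Omega ::
  "'a topology \<Rightarrow> ('a, 'e::euclidean_space) chart set \<Rightarrow> ('a \<Rightarrow> ('a, 'e) tvec \<Rightarrow> real)
     \<Rightarrow> (real \<Rightarrow> 'a) set" where
  "Omega X A \<omega> = {\<gamma>. continuous_map (top_of_set {0..1}) X \<gamma> \<and> piecewise_smooth A \<gamma> \<and> \<gamma> 0 = \<gamma> 1 \<and>
     (\<forall>s\<in>{0..1}. left_velocity A \<gamma> s \<in> kropina_dom A \<omega> (\<gamma> s) \<and>
                 right_velocity A \<gamma> s \<in> kropina_dom A \<omega> (\<gamma> s))}"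

text \<open>The left and right velocities of a curve in \<^const>\<open>Omega\<close> differ at finitely many points
  only, so the choice of the right velocity does not affect the energy.\<close>

definition energy ::
  "('a, 'e::euclidean_space) chart set \<Rightarrow> ('a \<Rightarrow> ('a, 'e) tvec \<Rightarrow> ('a, 'e) tvec \<Rightarrow> real)
     \<Rightarrow> ('a \<Rightarrow> ('a, 'e) tvec \<Rightarrow> real) \<Rightarrow> (real \<Rightarrow> 'a) \<Rightarrow> real" where
  "energy A g \<omega> \<gamma> = 1 / 2 * integral {0..1} (\<lambda>s. (kropina g \<omega> (\<gamma> s) (right_velocity A \<gamma> s))\<^sup>2)"

text \<open>A piecewise smooth variation of \<open>\<gamma>\<close> through curves of \<^const>\<open>Omega\<close>; all its curves share
  one partition.\<close>

definition variation ::
  "'a topology \<Rightarrow> ('a, 'e::euclidean_space) chart set \<Rightarrow> ('a \<Rightarrow> ('a, 'e) tvec \<Rightarrow> real)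
     \<Rightarrow> (real \<Rightarrow> 'a) \<Rightarrow> real \<Rightarrow> (real \<Rightarrow> real \<Rightarrow> 'a) \<Rightarrow> bool" where
  "variation X A \<omega> \<gamma> e H \<longleftrightarrow> e > 0 \<and>
     (\<forall>s\<in>{0..1}. H 0 s = \<gamma> s) \<and>
     (\<forall>r\<in>{-e<..<e}. H r \<in> Omega X A \<omega>) \<and>
     (\<exists>P. partition01 P \<and>
        (\<forall>a b. adjacent P a b \<longrightarrow> smooth_into A ({-e<..<e} \<times> {a..b}) (\<lambda>(r, s). H r s)))"

definition closed_geodesic ::
  "'a topology \<Rightarrow> ('a, 'e::euclidean_space) chart set
     \<Rightarrow> ('a \<Rightarrow> ('a, 'e) tvec \<Rightarrow> ('a, 'e) tvec \<Rightarrow> real) \<Rightarrow> ('a \<Rightarrow> ('a, 'e) tvec \<Rightarrow> real)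
     \<Rightarrow> (real \<Rightarrow> 'a) \<Rightarrow> bool" where
  "closed_geodesic X A g \<omega> \<gamma> \<longleftrightarrow> \<gamma> \<in> Omega X A \<omega> \<and>
     (\<forall>e H. variation X A \<omega> \<gamma> e H \<longrightarrow>
        ((\<lambda>r. energy A g \<omega> (H r)) has_real_derivative 0) (at 0))"

text \<open>Loops are compared through their periodic extensions to the real line. Hence shifts of the
  base point, and also iterates \<open>s \<mapsto> \<gamma>(k s)\<close> of a loop, count as reparametrizations.\<close>

definition reparametrization :: "(real \<Rightarrow> 'a) \<Rightarrow> (real \<Rightarrow> 'a) \<Rightarrow> bool" where
  "reparametrization \<gamma> \<delta> \<longleftrightarrow>
     (\<exists>\<psi> \<psi>'. homeomorphism UNIV UNIV \<psi> \<psi>' \<and> (\<forall>t. periodize \<delta> t = periodize \<gamma> (\<psi> t)))"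

end

theory Submission
  imports Defs
begin

text \<open>The function \<open>f = \<omega>(Y)\<close> is constant along the orbits of \<open>Y\<close>, and \<open>i\<^sub>Y d\<omega> = L\<^sub>Y \<omega> - df\<close> vanishes along
  an orbit that consists of critical points of \<open>f\<close>. Such an orbit is a closed geodesic of \<open>K\<close>: since \<open>Y\<close> is
  a Killing field of constant length, the first variations of \<open>g\<^sub>0(v,v)\<close> and of \<open>\<omega>(v)\<close> are
  total derivatives, whose coefficients in the variation of \<open>K\<^sup>2\<close> are constant along the orbit.
  The orbits through a maximum and a minimum of \<open>f\<close> are therefore geodesics. They differ if \<open>f\<close> is not
  constant; otherwise every orbit is a geodesic, and one orbit does not fill a manifold of dimension at least 2.\<close>

section \<open>Functions of class \<open>C\<^sup>k\<close>\<close>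

text \<open>No connection and no geodesic equation enter, only first derivatives of the coordinate
  expressions of \<open>g\<close>, \<open>\<omega>\<close> and \<open>Y\<close>. The condition
  \<open>\<omega>(Y) < 0\<close> makes the orbit admissible, non-constant, and the denominators of
  the variation formula nonzero. The obstacle is that a variation is smooth only on the cells of a
  partition and is readable in coordinates only near one point at a time, while the energy is an
  integral over the whole loop. Hence the claim is put into a form additive in the interval: the
  derivative at \<open>r = 0\<close> of the energy over \<open>[a,b]\<close> is
  \<open>\<Phi>(b) - \<Phi>(a)\<close>, with \<open>\<Phi>\<close> built from the variation field
  and independent of the chart. It is proved on short intervals inside one cell and one chart, and
  extended to \<open>[0,1]\<close> by bisection. Corners of the varied curves leave no trace,
  because the orbit itself is smooth and the variation field at a partition point does not depend on
  the side from which it is approached. Finally \<open>\<Phi>(1) = \<Phi>(0)\<close> because the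
  curves are closed.\<close>

lemma Ck_on_has_derivative:
  assumes "Ck_on (Suc k) f S" "x \<in> S"
  shows "(f has_derivative frechet_derivative f (at x)) (at x)"
  using assms frechet_derivative_works by auto

lemma Ck_on_SucD: "Ck_on (Suc k) f S \<Longrightarrow> Ck_on k f S"
proof (induction k arbitrary: f)
  case 0
  then show ?case
    by (auto intro!: continuous_at_imp_continuous_on differentiable_imp_continuous_within)
next
  case (Suc k)
  then show ?case by (metis Ck_on.simps(2))
qed

lemma frechet_derivative_eq_sum_Basis:
  fixes f :: "'x::euclidean_space \<Rightarrow> 'y::real_normed_vector"
  assumes "f differentiable (at x)"
  shows "frechet_derivative f (at x) v = (\<Sum>k\<in>Basis. (v \<bullet> k) *\<^sub>R frechet_derivative f (at x) k)"
proof -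
  interpret linear "frechet_derivative f (at x)"
    using assms by (rule linear_frechet_derivative)
  have "frechet_derivative f (at x) v = frechet_derivative f (at x) (\<Sum>k\<in>Basis. (v \<bullet> k) *\<^sub>R k)"
    by (simp add: euclidean_representation)
  then show ?thesis by (simp add: sum scale)
qed

text \<open>\<open>Ck_on\<close> controls the derivative only in each fixed direction. Expanding the
  moving direction \<open>v z\<close> in \<open>Basis\<close> leaves finitely many fixed
  ones.\<close>

lemma continuous_on_frechet_derivative:
  fixes f :: "'x::euclidean_space \<Rightarrow> 'y::real_normed_vector"
  assumes f: "Ck_on (Suc 0) f U"
    and x: "continuous_on Z x" and v: "continuous_on Z v" and U: "\<And>z. z \<in> Z \<Longrightarrow> x z \<in> U"
  shows "continuous_on Z (\<lambda>z. frechet_derivative f (at (x z)) (v z))"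
proof -
  have "continuous_on U (\<lambda>p. frechet_derivative f (at p) k)" for k
    using f by simp
  then have "continuous_on Z (\<lambda>z. frechet_derivative f (at (x z)) k)" for k
    by (rule continuous_on_compose2[OF _ x]) (use U in auto)
  then have "continuous_on Z (\<lambda>z. \<Sum>k\<in>Basis. (v z \<bullet> k) *\<^sub>R frechet_derivative f (at (x z)) k)"
    by (intro continuous_intros v)
  then show ?thesis
    by (rule continuous_on_eq) (use f U in \<open>simp flip: frechet_derivative_eq_sum_Basis\<close>)
qed

lemma Ck_on_cong:
  assumes "open S" "\<And>x. x \<in> S \<Longrightarrow> f x = g x" "Ck_on k f S"
  shows "Ck_on k g S"
  using assms
proof (induction k arbitrary: f g)
  case 0
  then show ?case using continuous_on_cong by force
next
  case (Suc k)
  have eq: "frechet_derivative f (at x) v = frechet_derivative g (at x) v" if "x \<in> S" for x v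
    by (rule fun_cong[OF frechet_derivative_transform_within_open]) (use Suc.prems that in auto)
  have "g differentiable (at x)" if "x \<in> S" for x
    using has_derivative_transform_within_open[OF Ck_on_has_derivative[OF Suc.prems(3) that] Suc.prems(1) that Suc.prems(2)]
    by (auto simp: differentiable_def)
  moreover have "Ck_on k (\<lambda>x. frechet_derivative g (at x) v) S" for v
    by (rule Suc.IH[of "\<lambda>x. frechet_derivative f (at x) v"]) (use Suc.prems eq in auto)
  ultimately show ?case by simp
qed

text \<open>The derivative in direction \<open>v\<close> is again a function of
  \<open>c *\<^sub>R x\<close>, namely the derivative of \<open>f\<close> in direction
  \<open>c *\<^sub>R v\<close>, so the induction closes without a general chain rule. This serves to
  rescale an orbit of period \<open>T\<close> to \<open>[0,1]\<close>.\<close>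

lemma Ck_on_compose_scaleR:
  assumes "open S" "Ck_on k f S"
  shows "Ck_on k (\<lambda>x. f (c *\<^sub>R x)) ((\<lambda>x. c *\<^sub>R x) -` S)"
  using assms
proof (induction k arbitrary: f)
  case 0
  then show ?case
    by (auto intro!: continuous_on_compose2[where f="\<lambda>x. c *\<^sub>R x"] continuous_intros)
next
  case (Suc k)
  have op: "open ((\<lambda>x. c *\<^sub>R x) -` S)"
    by (intro open_vimage Suc.prems continuous_intros)
  have d: "((\<lambda>x. f (c *\<^sub>R x)) has_derivative (\<lambda>v. frechet_derivative f (at (c *\<^sub>R x)) (c *\<^sub>R v))) (at x)"
    if "c *\<^sub>R x \<in> S" for x
    by (rule has_derivative_compose[of "\<lambda>x. c *\<^sub>R x", OF _ Ck_on_has_derivative[OF Suc.prems(2) that]])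
      (auto intro!: derivative_eq_intros)
  have "Ck_on k (\<lambda>x. frechet_derivative (\<lambda>x. f (c *\<^sub>R x)) (at x) v) ((\<lambda>x. c *\<^sub>R x) -` S)" for v
    by (rule Ck_on_cong[OF op, of "\<lambda>x. frechet_derivative f (at (c *\<^sub>R x)) (c *\<^sub>R v)"])
      (use Suc in \<open>auto simp: fun_cong[OF frechet_derivative_at[OF d]]\<close>)
  with d show ?case by (auto simp: differentiable_def)
qed

lemma smooth_on_compose_scaleR:
  assumes "open S" "smooth_on S f"
  shows "smooth_on ((\<lambda>x. c *\<^sub>R x) -` S) (\<lambda>x. f (c *\<^sub>R x))"
  using assms Ck_on_compose_scaleR unfolding smooth_on_def by blast


section \<open>Differentiable families of linear and bilinear forms\<close>

text \<open>A one-form read in a chart with image \<open>U\<close>. Regularity is asked for constant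
  \<open>u\<close> only, as in \<open>smooth_one_form\<close>; linearity supplies the joint
  regularity in point and vector through \<open>expand\<close>.\<close>

locale C1_form =
  fixes U :: "'e::euclidean_space set" and om :: "'e \<Rightarrow> 'e \<Rightarrow> real"
  assumes open_U: "open U"
    and lin: "x \<in> U \<Longrightarrow> linear (om x)"
    and C1: "Ck_on (Suc 0) (\<lambda>x. om x u) U"
begin

lemma expand: "x \<in> U \<Longrightarrow> om x u = (\<Sum>i\<in>Basis. (u \<bullet> i) * om x i)"
  using linear_sum[OF lin, of x "\<lambda>i. (u \<bullet> i) *\<^sub>R i" Basis] linear_scale[OF lin, of x]
  by (simp add: euclidean_representation)

lemma frechet_expand:
  assumes "x \<in> U"
  shows "frechet_derivative (\<lambda>p. om p u) (at x) v = (\<Sum>i\<in>Basis. (u \<bullet> i) * frechet_derivative (\<lambda>p. om p i) (at x) v)"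
proof -
  have *: "((\<lambda>p. om p i) has_derivative frechet_derivative (\<lambda>p. om p i) (at x)) (at x)" for i
    by (rule Ck_on_has_derivative[OF C1 assms])
  have "((\<lambda>p. \<Sum>i\<in>Basis. (u \<bullet> i) * om p i) has_derivative (\<lambda>v. \<Sum>i\<in>Basis. (u \<bullet> i) * frechet_derivative (\<lambda>p. om p i) (at x) v)) (at x)"
    by (auto intro!: derivative_eq_intros *)
  then have "((\<lambda>p. om p u) has_derivative (\<lambda>v. \<Sum>i\<in>Basis. (u \<bullet> i) * frechet_derivative (\<lambda>p. om p i) (at x) v)) (at x)"
    by (rule has_derivative_transform_within_open[OF _ open_U assms]) (simp add: expand[of _ "u"])
  then show ?thesis by (metis (no_types, lifting) frechet_derivative_at)
qed

lemma frechet_scale: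
  assumes "x \<in> U"
  shows "frechet_derivative (\<lambda>p. om p (a *\<^sub>R u)) (at x) v = a * frechet_derivative (\<lambda>p. om p u) (at x) v"
    and "frechet_derivative (\<lambda>p. om p u) (at x) (b *\<^sub>R v) = b * frechet_derivative (\<lambda>p. om p u) (at x) v"
  using linear_scale[OF has_derivative_linear[OF Ck_on_has_derivative[OF C1 assms]]]
  by (simp_all add: frechet_expand[OF assms, of "a *\<^sub>R u"] frechet_expand[OF assms, of u] sum_distrib_left algebra_simps)

text \<open>A product rule in which the point and the vector both move: after \<open>expand\<close>
  it is the rule for products of scalar functions. The filter \<open>at t within S\<close> covers
  one-sided derivatives at ends of intervals.\<close>

lemma has_derivative:
  assumes t: "t \<in> S" and x: "(x has_vector_derivative x') (at t within S)"
    and u: "(u has_vector_derivative u') (at t within S)" and xU: "\<And>\<tau>. \<tau> \<in> S \<Longrightarrow> x \<tau> \<in> U"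
  shows "((\<lambda>\<tau>. om (x \<tau>) (u \<tau>)) has_real_derivative
           frechet_derivative (\<lambda>p. om p (u t)) (at (x t)) x' + om (x t) u') (at t within S)"
proof -
  let ?D = "\<lambda>i. frechet_derivative (\<lambda>p. om p i) (at (x t))"
  have *: "((\<lambda>p. om p i) has_derivative ?D i) (at (x t))" for i
    by (rule Ck_on_has_derivative[OF C1 xU[OF t]])
  have xd: "((\<lambda>\<tau>. om (x \<tau>) i) has_real_derivative ?D i x') (at t within S)" for i
  proof -
    have "((\<lambda>\<tau>. om (x \<tau>) i) has_derivative (\<lambda>h. ?D i (h *\<^sub>R x'))) (at t within S)"
      using x unfolding has_vector_derivative_def by (rule has_derivative_compose[where g="\<lambda>p. om p i"]) (rule *)
    moreover have "?D i (h *\<^sub>R x') = ?D i x' * h" for h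
      using linear_scale[OF has_derivative_linear[OF *]] by simp
    ultimately show ?thesis by (simp add: has_field_derivative_def)
  qed
  have ud: "((\<lambda>\<tau>. u \<tau> \<bullet> i) has_real_derivative (u' \<bullet> i)) (at t within S)" for i
    using u unfolding has_vector_derivative_def has_field_derivative_def
    by (auto intro!: derivative_eq_intros)
  have "((\<lambda>\<tau>. \<Sum>i\<in>Basis. (u \<tau> \<bullet> i) * om (x \<tau>) i) has_real_derivative
      (\<Sum>i\<in>Basis. (u t \<bullet> i) * ?D i x' + (u' \<bullet> i) * om (x t) i)) (at t within S)"
    by (auto intro!: derivative_eq_intros ud xd sum.cong)
  moreover have "(\<Sum>i\<in>Basis. (u t \<bullet> i) * ?D i x' + (u' \<bullet> i) * om (x t) i) = ?D (u t) x' + om (x t) u'"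
    by (simp add: sum.distrib flip: expand[OF xU[OF t]] frechet_expand[OF xU[OF t]])
  ultimately show ?thesis
    unfolding has_field_derivative_def
    using has_derivative_transform[OF t, of "\<lambda>\<tau>. om (x \<tau>) (u \<tau>)"
      "\<lambda>\<tau>. \<Sum>i\<in>Basis. (u \<tau> \<bullet> i) * om (x \<tau>) i"] expand xU
    by simp
qed

lemma continuous:
  assumes "continuous_on Z x" "continuous_on Z u" "\<And>z. z \<in> Z \<Longrightarrow> x z \<in> U"
  shows "continuous_on Z (\<lambda>z. om (x z) (u z))"
proof -
  have "continuous_on U (\<lambda>p. om p i)" for i
    using Ck_on_SucD[OF C1] by simp
  then have "continuous_on Z (\<lambda>z. om (x z) i)" for i
    by (rule continuous_on_compose2[OF _ assms(1)]) (use assms in auto)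
  then have "continuous_on Z (\<lambda>z. \<Sum>i\<in>Basis. (u z \<bullet> i) * om (x z) i)"
    by (intro continuous_intros assms)
  then show ?thesis
    by (rule continuous_on_eq) (simp add: expand[OF assms(3), of _ "u _"])
qed

lemma continuous_frechet:
  assumes "continuous_on Z x" "continuous_on Z u" "continuous_on Z v" "\<And>z. z \<in> Z \<Longrightarrow> x z \<in> U"
  shows "continuous_on Z (\<lambda>z. frechet_derivative (\<lambda>p. om p (u z)) (at (x z)) (v z))"
proof -
  have "continuous_on Z (\<lambda>z. \<Sum>i\<in>Basis. (u z \<bullet> i) * frechet_derivative (\<lambda>p. om p i) (at (x z)) (v z))"
    by (intro continuous_intros assms continuous_on_frechet_derivative[OF C1])
  then show ?thesis
    by (rule continuous_on_eq) (simp add: frechet_expand[OF assms(4), of _ "u _"])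
qed

end

text \<open>Freezing one argument gives a \<open>C1_form\<close> (the sublocales \<open>left\<close>
  and \<open>right\<close>), so each fact below reduces to its linear version by expanding the other
  argument.\<close>

locale C1_bilinear =
  fixes U :: "'e::euclidean_space set" and gg :: "'e \<Rightarrow> 'e \<Rightarrow> 'e \<Rightarrow> real"
  assumes open_U: "open U"
    and lin1: "x \<in> U \<Longrightarrow> linear (\<lambda>u. gg x u w)"
    and sym: "x \<in> U \<Longrightarrow> gg x u w = gg x w u"
    and C1: "Ck_on (Suc 0) (\<lambda>x. gg x u w) U"
begin

sublocale left: C1_form U "\<lambda>x u. gg x u w" for w
  by (rule C1_form.intro[OF open_U lin1 C1])

lemma lin2: "x \<in> U \<Longrightarrow> linear (gg x u)"
  using lin1[of x u] sym[of x u] by (metis (no_types, lifting) ext)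

sublocale right: C1_form U "\<lambda>x w. gg x u w" for u
  by (rule C1_form.intro[OF open_U lin2 C1])

lemma has_derivative:
  assumes t: "t \<in> S" and x: "(x has_vector_derivative x') (at t within S)"
    and u: "(u has_vector_derivative u') (at t within S)"
    and w: "(w has_vector_derivative w') (at t within S)" and xU: "\<And>\<tau>. \<tau> \<in> S \<Longrightarrow> x \<tau> \<in> U"
  shows "((\<lambda>\<tau>. gg (x \<tau>) (u \<tau>) (w \<tau>)) has_real_derivative
           frechet_derivative (\<lambda>p. gg p (u t) (w t)) (at (x t)) x' + gg (x t) u' (w t) + gg (x t) (u t) w')
           (at t within S)"
proof -
  let ?D = "\<lambda>i. frechet_derivative (\<lambda>p. gg p (u t) i) (at (x t))"
  have wd: "((\<lambda>\<tau>. w \<tau> \<bullet> i) has_real_derivative (w' \<bullet> i)) (at t within S)" for i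
    using w unfolding has_vector_derivative_def has_field_derivative_def
    by (auto intro!: derivative_eq_intros)
  have "((\<lambda>\<tau>. \<Sum>i\<in>Basis. (w \<tau> \<bullet> i) * gg (x \<tau>) (u \<tau>) i) has_real_derivative
      (\<Sum>i\<in>Basis. (w' \<bullet> i) * gg (x t) (u t) i + (w t \<bullet> i) * ?D i x' + (w t \<bullet> i) * gg (x t) u' i)) (at t within S)"
    by (auto intro!: derivative_eq_intros wd left.has_derivative[OF t x u xU] sum.cong simp: algebra_simps)
  moreover have "(\<Sum>i\<in>Basis. (w' \<bullet> i) * gg (x t) (u t) i + (w t \<bullet> i) * ?D i x' + (w t \<bullet> i) * gg (x t) u' i)
      = ?D (w t) x' + gg (x t) u' (w t) + gg (x t) (u t) w'"
    by (simp add: sum.distrib flip: right.expand[OF xU[OF t]] right.frechet_expand[OF xU[OF t]])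
  moreover have "gg (x \<tau>) (u \<tau>) (w \<tau>) = (\<Sum>i\<in>Basis. (w \<tau> \<bullet> i) * gg (x \<tau>) (u \<tau>) i)" if "\<tau> \<in> S" for \<tau>
    by (rule right.expand[OF xU[OF that]])
  ultimately show ?thesis
    unfolding has_field_derivative_def
    using has_derivative_transform[OF t, of "\<lambda>\<tau>. gg (x \<tau>) (u \<tau>) (w \<tau>)"
      "\<lambda>\<tau>. \<Sum>i\<in>Basis. (w \<tau> \<bullet> i) * gg (x \<tau>) (u \<tau>) i"]
    by simp
qed

lemma continuous:
  assumes "continuous_on Z x" "continuous_on Z u" "continuous_on Z w" "\<And>z. z \<in> Z \<Longrightarrow> x z \<in> U"
  shows "continuous_on Z (\<lambda>z. gg (x z) (u z) (w z))"
proof -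
  have "continuous_on Z (\<lambda>z. \<Sum>i\<in>Basis. (w z \<bullet> i) * gg (x z) (u z) i)"
    by (intro continuous_intros assms left.continuous)
  then show ?thesis
    by (rule continuous_on_eq) (simp add: right.expand[OF assms(4), of _ _ "w _"])
qed

lemma continuous_frechet:
  assumes "continuous_on Z x" "continuous_on Z u" "continuous_on Z w" "continuous_on Z v"
    "\<And>z. z \<in> Z \<Longrightarrow> x z \<in> U"
  shows "continuous_on Z (\<lambda>z. frechet_derivative (\<lambda>p. gg p (u z) (w z)) (at (x z)) (v z))"
proof -
  have "continuous_on Z (\<lambda>z. \<Sum>i\<in>Basis. (w z \<bullet> i) * frechet_derivative (\<lambda>p. gg p (u z) i) (at (x z)) (v z))"
    by (intro continuous_intros assms left.continuous_frechet)
  then show ?thesis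
    by (rule continuous_on_eq) (simp add: right.frechet_expand[OF assms(5), of _ _ "w _"])
qed

end


section \<open>Partial derivatives in the plane\<close>

definition partial :: "real \<times> real \<Rightarrow> (real \<times> real \<Rightarrow> 'y::real_normed_vector) \<Rightarrow> real \<times> real \<Rightarrow> 'y" where
  "partial v h z = frechet_derivative h (at z) v"

lemma has_vector_derivative_partial:
  fixes h :: "real \<times> real \<Rightarrow> 'y::real_normed_vector"
  assumes "Ck_on (Suc k) h W" "(r, s) \<in> W"
  shows "((\<lambda>r. h (r, s)) has_vector_derivative partial (1, 0) h (r, s)) (at r within R)"
    and "((\<lambda>s. h (r, s)) has_vector_derivative partial (0, 1) h (r, s)) (at s within R)"
proof -
  have h: "(h has_derivative frechet_derivative h (at (r, s))) (at (r, s))"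
    by (rule Ck_on_has_derivative[OF assms])
  have lin: "t *\<^sub>R frechet_derivative h (at (r, s)) v = frechet_derivative h (at (r, s)) (t *\<^sub>R v)" for t v
    by (simp add: linear_scale[OF has_derivative_linear[OF h]])
  have "((\<lambda>r. h (r, s)) has_derivative (\<lambda>t. frechet_derivative h (at (r, s)) (t, 0))) (at r within R)"
    by (rule has_derivative_compose[where g=h and g'="frechet_derivative h (at (r, s))"])
      (auto intro!: derivative_eq_intros h)
  then show "((\<lambda>r. h (r, s)) has_vector_derivative partial (1, 0) h (r, s)) (at r within R)"
    by (simp add: has_vector_derivative_def partial_def lin)
  have "((\<lambda>s. h (r, s)) has_derivative (\<lambda>t. frechet_derivative h (at (r, s)) (0, t))) (at s within R)"
    by (rule has_derivative_compose[where g=h and g'="frechet_derivative h (at (r, s))"])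
      (auto intro!: derivative_eq_intros h)
  then show "((\<lambda>s. h (r, s)) has_vector_derivative partial (0, 1) h (r, s)) (at s within R)"
    by (simp add: has_vector_derivative_def partial_def lin)
qed

lemma Ck_on_partial: "Ck_on (Suc k) h W \<Longrightarrow> Ck_on k (partial v h) W"
  by (cases v) (simp add: partial_def[abs_def])

text \<open>Symmetry of the second derivatives on a rectangle, by differentiating
  \<open>h (r, s) = h (r, c) + \<integral>\<^sub>c\<^sup>s \<partial>\<^sub>2 h (r, \<sigma>) d\<sigma>\<close> under the integral sign.\<close>

lemma mixed_partials:
  fixes h :: "real \<times> real \<Rightarrow> 'y::euclidean_space"
  assumes h: "Ck_on (Suc (Suc 0)) h W" and box: "{-\<delta>..\<delta>} \<times> {c..d} \<subseteq> W" and "\<delta> > 0" and s: "s \<in> {c..d}"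
  shows "((\<lambda>s. partial (1, 0) h (0, s)) has_vector_derivative partial (1, 0) (partial (0, 1) h) (0, s))
           (at s within {c..d})"
proof -
  have h1: "Ck_on (Suc 0) (partial v h) W" for v
    using h by (rule Ck_on_partial)
  have cont1: "continuous_on ({-\<delta>..\<delta>} \<times> {c..d}) (partial v h)" for v
    using Ck_on_SucD[OF h1[of v]] box by (auto intro: continuous_on_subset)
  have cont2: "continuous_on ({-\<delta>..\<delta>} \<times> {c..d}) (partial (1, 0) (partial (0, 1) h))"
    using Ck_on_partial[OF h1[of "(0, 1)"], of "(1, 0)"] box by (auto intro: continuous_on_subset)
  have slice: "continuous_on {c..d} (\<lambda>\<sigma>. f (r, \<sigma>))"
    if "continuous_on ({-\<delta>..\<delta>} \<times> {c..d}) f" "r \<in> {-\<delta>..\<delta>}" for f :: "real \<times> real \<Rightarrow> 'y" and r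
    by (rule continuous_on_compose2[OF that(1)]) (use that in \<open>auto intro!: continuous_intros\<close>)
  have eq: "partial (1, 0) h (0, t) = partial (1, 0) h (0, c) + integral {c..t} (\<lambda>\<sigma>. partial (1, 0) (partial (0, 1) h) (0, \<sigma>))"
    if t: "t \<in> {c..d}" for t
  proof -
    have sub: "{-\<delta>..\<delta>} \<times> cbox c t \<subseteq> {-\<delta>..\<delta>} \<times> {c..d}"
      using t by auto
    have "((\<lambda>r. integral (cbox c t) (\<lambda>\<sigma>. partial (0, 1) h (r, \<sigma>))) has_vector_derivative
        integral (cbox c t) (\<lambda>\<sigma>. partial (1, 0) (partial (0, 1) h) (0, \<sigma>))) (at 0 within {-\<delta>..\<delta>})"
    proof (rule leibniz_rule_vector_derivative[where fx="\<lambda>r \<sigma>. partial (1, 0) (partial (0, 1) h) (r, \<sigma>)"])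
      fix r \<sigma> assume "r \<in> {-\<delta>..\<delta>}" "\<sigma> \<in> cbox c t"
      then have "(r, \<sigma>) \<in> W" using box t by auto
      then show "((\<lambda>r. partial (0, 1) h (r, \<sigma>)) has_vector_derivative partial (1, 0) (partial (0, 1) h) (r, \<sigma>))
          (at r within {-\<delta>..\<delta>})"
        by (rule has_vector_derivative_partial[OF h1])
    next
      fix r assume "r \<in> {-\<delta>..\<delta>}"
      then have "continuous_on {c..t} (\<lambda>\<sigma>. partial (0, 1) h (r, \<sigma>))"
        using continuous_on_subset[OF slice[OF cont1]] t by simp
      then show "(\<lambda>\<sigma>. partial (0, 1) h (r, \<sigma>)) integrable_on cbox c t"
        by (simp add: integrable_continuous_real)
    qed (use \<open>\<delta> > 0\<close> continuous_on_subset[OF cont2 sub] in auto)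
    moreover have "h (r, t) - h (r, c) = integral (cbox c t) (\<lambda>\<sigma>. partial (0, 1) h (r, \<sigma>))"
      if r: "r \<in> {-\<delta>..\<delta>}" for r
    proof (rule integral_unique[symmetric])
      show "((\<lambda>\<sigma>. partial (0, 1) h (r, \<sigma>)) has_integral h (r, t) - h (r, c)) (cbox c t)"
        unfolding box_real
        by (rule fundamental_theorem_of_calculus)
          (use t r box in \<open>auto intro!: has_vector_derivative_partial[OF h]\<close>)
    qed
    ultimately have "((\<lambda>r. h (r, t) - h (r, c)) has_vector_derivative
        integral (cbox c t) (\<lambda>\<sigma>. partial (1, 0) (partial (0, 1) h) (0, \<sigma>))) (at 0 within {-\<delta>..\<delta>})"
      using \<open>\<delta> > 0\<close> by (intro has_vector_derivative_transform[of 0 _ "\<lambda>r. h (r, t) - h (r, c)"]) auto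
    moreover have "((\<lambda>r. h (r, t) - h (r, c)) has_vector_derivative
        partial (1, 0) h (0, t) - partial (1, 0) h (0, c)) (at 0 within {-\<delta>..\<delta>})"
      by (intro has_vector_derivative_diff has_vector_derivative_partial[OF h])
        (use box t \<open>\<delta> > 0\<close> in auto)
    \<comment> \<open>Both sides are the derivative at \<open>r = 0\<close> of
      \<open>h (r, t) - h (r, c)\<close>, computed once under the integral sign and once term by
      term.\<close>
    ultimately have "integral {c..t} (\<lambda>\<sigma>. partial (1, 0) (partial (0, 1) h) (0, \<sigma>)) =
        partial (1, 0) h (0, t) - partial (1, 0) h (0, c)"
      using vector_derivative_unique_within_closed_interval[of "-\<delta>" \<delta> 0] \<open>\<delta> > 0\<close> by fastforce
    then show ?thesis by simp
  qed
  have "((\<lambda>t. partial (1, 0) h (0, c) + integral {c..t} (\<lambda>\<sigma>. partial (1, 0) (partial (0, 1) h) (0, \<sigma>)))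
      has_vector_derivative 0 + partial (1, 0) (partial (0, 1) h) (0, s)) (at s within {c..d})"
    by (intro has_vector_derivative_add has_vector_derivative_const integral_has_vector_derivative slice[OF cont2] s)
      (use \<open>\<delta> > 0\<close> in auto)
  then show ?thesis
    using has_vector_derivative_transform[OF s eq] by simp
qed


section \<open>The first variation in a chart\<close>

text \<open>The hypotheses on \<open>Y\<close> in one chart: \<open>killing\<close> and
  \<open>lie\<close> are \<open>L_Y g = 0\<close> and \<open>L_Y \<omega> = 0\<close> evaluated on
  constant coordinate fields. The plus signs come from
  \<open>[Y, \<partial>_u] = - D_u Y\<close>.\<close>

locale killing_chart = G: C1_bilinear U gg + O: C1_form U om
  for U :: "'e::euclidean_space set" and gg :: "'e \<Rightarrow> 'e \<Rightarrow> 'e \<Rightarrow> real" and om :: "'e \<Rightarrow> 'e \<Rightarrow> real" +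
  fixes y :: "'e \<Rightarrow> 'e" and \<kappa> :: real
  assumes y: "Ck_on (Suc 0) y U"
    and killing: "x \<in> U \<Longrightarrow> frechet_derivative (\<lambda>p. gg p u w) (at x) (y x)
           + gg x (frechet_derivative y (at x) u) w + gg x u (frechet_derivative y (at x) w) = 0"
    and lie: "x \<in> U \<Longrightarrow> frechet_derivative (\<lambda>p. om p u) (at x) (y x)
           + om x (frechet_derivative y (at x) u) = 0"
    and length: "x \<in> U \<Longrightarrow> gg x (y x) (y x) = \<kappa>"
begin

lemma y_along:
  assumes "t \<in> S" "(x has_vector_derivative x') (at t within S)" "\<And>\<tau>. \<tau> \<in> S \<Longrightarrow> x \<tau> \<in> U"
  shows "((\<lambda>\<tau>. y (x \<tau>)) has_vector_derivative frechet_derivative y (at (x t)) x') (at t within S)"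
proof -
  have *: "(y has_derivative frechet_derivative y (at (x t))) (at (x t))"
    by (rule Ck_on_has_derivative[OF y]) (use assms in auto)
  show ?thesis
    using has_derivative_compose[OF assms(2)[unfolded has_vector_derivative_def] *]
    by (simp add: has_vector_derivative_def linear_scale[OF has_derivative_linear[OF *]])
qed

lemma diag_along:
  assumes "t \<in> S" "(x has_vector_derivative x') (at t within S)" "\<And>\<tau>. \<tau> \<in> S \<Longrightarrow> x \<tau> \<in> U"
  shows "((\<lambda>\<tau>. om (x \<tau>) (y (x \<tau>))) has_real_derivative
           frechet_derivative (\<lambda>p. om p (y (x t))) (at (x t)) x' + om (x t) (frechet_derivative y (at (x t)) x'))
           (at t within S)"
  by (rule O.has_derivative[OF assms(1,2) y_along[OF assms] assms(3)])

text \<open>For the velocity \<open>y (x t)\<close> the derivative in \<open>diag_along\<close> is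
  the left-hand side of \<open>lie\<close> with \<open>u = y (x t)\<close>. This is
  \<open>Y(\<omega>(Y)) = (L_Y \<omega>)(Y)\<close>, as \<open>[Y,Y] = 0\<close>.\<close>

lemma diag_orbit:
  assumes "t \<in> S" "(x has_vector_derivative y (x t)) (at t within S)" "\<And>\<tau>. \<tau> \<in> S \<Longrightarrow> x \<tau> \<in> U"
  shows "((\<lambda>\<tau>. om (x \<tau>) (y (x \<tau>))) has_real_derivative 0) (at t within S)"
  using diag_along[OF assms] lie[OF assms(3)[OF assms(1)]] by simp

lemma line_in_U:
  assumes "x \<in> U"
  shows "open {\<tau>::real. x + \<tau> *\<^sub>R v \<in> U}"
proof -
  have "open ((\<lambda>\<tau>::real. x + \<tau> *\<^sub>R v) -` U)"
    by (intro open_vimage O.open_U continuous_intros)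
  then show ?thesis by (simp add: vimage_def)
qed

text \<open>Fermat's rule along the line \<open>x + \<tau> v\<close>: the left-hand side is the
  differential of \<open>\<omega>(Y)\<close> applied to \<open>v\<close>. It later allows the
  derivative of \<open>om\<close> in the direction of the variation field to be traded for a
  derivative of \<open>y\<close>.\<close>

lemma extremum_imp_critical:
  assumes x: "x \<in> U"
    and ex: "(\<forall>p\<in>U. om p (y p) \<le> om x (y x)) \<or> (\<forall>p\<in>U. om x (y x) \<le> om p (y p))"
  shows "frechet_derivative (\<lambda>p. om p (y x)) (at x) v + om x (frechet_derivative y (at x) v) = 0"
proof -
  let ?S = "{\<tau>. x + \<tau> *\<^sub>R v \<in> U}"
  have l: "((\<lambda>\<tau>. x + \<tau> *\<^sub>R v) has_vector_derivative v) (at 0 within ?S)"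
    by (auto intro!: derivative_eq_intros)
  have at: "at 0 within ?S = at 0"
    by (rule at_within_open[OF _ line_in_U[OF x]]) (use x in simp)
  have D: "((\<lambda>\<tau>. om (x + \<tau> *\<^sub>R v) (y (x + \<tau> *\<^sub>R v))) has_real_derivative
      frechet_derivative (\<lambda>p. om p (y x)) (at x) v + om x (frechet_derivative y (at x) v)) (at 0)"
    by (rule DERIV_cong[OF diag_along[OF _ l, unfolded at]]) (use x in auto)
  obtain e where "e > 0" "ball 0 e \<subseteq> ?S"
    using openE[OF line_in_U[OF x, of v], of 0] x by auto
  then have e: "\<And>\<tau>. \<bar>0 - \<tau>\<bar> < e \<Longrightarrow> x + \<tau> *\<^sub>R v \<in> U"
    by (auto simp: subset_iff)
  from ex show ?thesis
  proof
    assume "\<forall>p\<in>U. om p (y p) \<le> om x (y x)"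
    then show ?thesis using e by (intro DERIV_local_max[OF D \<open>e > 0\<close>]) auto
  next
    assume "\<forall>p\<in>U. om x (y x) \<le> om p (y p)"
    then show ?thesis using e by (intro DERIV_local_min[OF D \<open>e > 0\<close>]) auto
  qed
qed

text \<open>The constant \<open>\<kappa>\<close> is differentiated along a line; symmetry of
  \<open>gg\<close> merges the two terms in which \<open>y\<close> varies.\<close>

lemma length_deriv:
  assumes x: "x \<in> U"
  shows "frechet_derivative (\<lambda>p. gg p (y x) (y x)) (at x) v + 2 * gg x (y x) (frechet_derivative y (at x) v) = 0"
proof -
  let ?S = "{\<tau>. x + \<tau> *\<^sub>R v \<in> U}"
  have l: "((\<lambda>\<tau>. x + \<tau> *\<^sub>R v) has_vector_derivative v) (at 0 within ?S)"
    by (auto intro!: derivative_eq_intros)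
  have at: "at 0 within ?S = at 0"
    by (rule at_within_open[OF _ line_in_U[OF x]]) (use x in simp)
  have yl: "((\<lambda>\<tau>. y (x + \<tau> *\<^sub>R v)) has_vector_derivative frechet_derivative y (at (x + 0 *\<^sub>R v)) v) (at 0 within ?S)"
    by (rule y_along[OF _ l]) (use x in auto)
  have "((\<lambda>\<tau>. gg (x + \<tau> *\<^sub>R v) (y (x + \<tau> *\<^sub>R v)) (y (x + \<tau> *\<^sub>R v))) has_real_derivative
      frechet_derivative (\<lambda>p. gg p (y x) (y x)) (at x) v + 2 * gg x (y x) (frechet_derivative y (at x) v)) (at 0 within ?S)"
    by (rule DERIV_cong[OF G.has_derivative[OF _ l yl yl]]) (use x in \<open>auto simp: G.sym[OF x, of _ "y x"]\<close>)
  then have "((\<lambda>\<tau>. \<kappa>) has_real_derivative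
      frechet_derivative (\<lambda>p. gg p (y x) (y x)) (at x) v + 2 * gg x (y x) (frechet_derivative y (at x) v)) (at 0 within ?S)"
    unfolding has_field_derivative_def
    by (rule has_derivative_transform[rotated 2]) (use x length in auto)
  then show ?thesis
    unfolding at by (rule DERIV_unique[OF _ DERIV_const])
qed

text \<open>The commutation \<open>\<partial>\<^sub>r \<partial>\<^sub>s = \<partial>\<^sub>s \<partial>\<^sub>r\<close> and the invariance of \<open>g\<close> and \<open>\<omega>\<close> under the flow of \<open>Y\<close> turn the first
  variation of the Kropina energy density at an orbit into the derivative of \<open>boundary_term\<close>.\<close>

definition boundary_term :: "real \<Rightarrow> real \<Rightarrow> 'e \<Rightarrow> 'e \<Rightarrow> real" where
  "boundary_term T m x V = T * \<kappa> / m\<^sup>2 * gg x (y x) V - T * \<kappa>\<^sup>2 / (2 * m ^ 3) * om x V"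

text \<open>Only the curve at \<open>r = 0\<close> is an orbit (\<open>flow\<close>,
  \<open>crit\<close>, \<open>m\<close>); of the other curves it is required merely that they stay
  in the chart and that the denominator does not vanish. Derivatives in \<open>s\<close> are taken
  within \<open>{c..d}\<close>, since \<open>flow\<close> is known only there.\<close>

lemma first_variation:
  fixes h :: "real \<times> real \<Rightarrow> 'e"
  defines "dr \<equiv> partial (1, 0) h" and "ds \<equiv> partial (0, 1) h"
  assumes h: "Ck_on (Suc (Suc 0)) h D" and box: "{-\<delta>..\<delta>} \<times> {c..d} \<subseteq> D" and "\<delta> > 0" and "c \<le> d"
    and hU: "\<And>z. z \<in> {-\<delta>..\<delta>} \<times> {c..d} \<Longrightarrow> h z \<in> U"
    and flow: "\<And>s. s \<in> {c..d} \<Longrightarrow> ds (0, s) = T *\<^sub>R y (h (0, s))"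
    and crit: "\<And>s v. s \<in> {c..d} \<Longrightarrow> frechet_derivative (\<lambda>p. om p (y (h (0, s)))) (at (h (0, s))) v
             + om (h (0, s)) (frechet_derivative y (at (h (0, s))) v) = 0"
    and m: "\<And>s. s \<in> {c..d} \<Longrightarrow> om (h (0, s)) (y (h (0, s))) = m"
    and nz: "\<And>z. z \<in> {-\<delta>..\<delta>} \<times> {c..d} \<Longrightarrow> om (h z) (ds z) \<noteq> 0"
  defines "F \<equiv> \<lambda>r s. (gg (h (r, s)) (ds (r, s)) (ds (r, s)) / (2 * om (h (r, s)) (ds (r, s))))\<^sup>2"
  shows "\<And>r. r \<in> {-\<delta>..\<delta>} \<Longrightarrow> F r integrable_on {c..d}"
    and "((\<lambda>r. integral {c..d} (F r)) has_real_derivative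
           boundary_term T m (h (0, d)) (dr (0, d)) - boundary_term T m (h (0, c)) (dr (0, c))) (at 0)"
proof -
  define B where "B = {-\<delta>..\<delta>} \<times> {c..d}"
  define dd where "dd = partial (1, 0) ds"
  have h1: "Ck_on (Suc 0) (partial v h) D" for v
    using h by (rule Ck_on_partial)
  have cont_h: "continuous_on B h"
    using Ck_on_SucD[OF Ck_on_SucD[OF h]] box by (auto simp: B_def intro: continuous_on_subset)
  have cont1: "continuous_on B (partial v h)" for v
    using Ck_on_SucD[OF h1[of v]] box by (auto simp: B_def intro: continuous_on_subset)
  have cont2: "continuous_on B dd"
    using Ck_on_partial[OF h1[of "(0, 1)"], of "(1, 0)"] box
    by (auto simp: B_def dd_def ds_def intro: continuous_on_subset)
  have slice: "continuous_on {c..d} (\<lambda>\<sigma>. f (r, \<sigma>))"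
    if "continuous_on B f" "r \<in> {-\<delta>..\<delta>}" for f :: "real \<times> real \<Rightarrow> real" and r
    by (rule continuous_on_compose2[OF that(1)]) (use that in \<open>auto simp: B_def intro!: continuous_intros\<close>)
  \<comment> \<open>The density is \<open>F = (G / (2 W))^2\<close>; \<open>Gr\<close>,
    \<open>Wr\<close> and \<open>Fr\<close> are the derivatives in \<open>r\<close> of
    \<open>G\<close>, \<open>W\<close> and \<open>F\<close>. Here \<open>ds\<close> is the velocity,
    \<open>dr\<close> the variation field and \<open>dd\<close> the \<open>r\<close>-derivative of
    the velocity.\<close>
  define G W where "G z = gg (h z) (ds z) (ds z)" and "W z = om (h z) (ds z)" for z
  define Gr Wr where "Gr z = frechet_derivative (\<lambda>p. gg p (ds z) (ds z)) (at (h z)) (dr z) + 2 * gg (h z) (ds z) (dd z)"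
    and "Wr z = frechet_derivative (\<lambda>p. om p (ds z)) (at (h z)) (dr z) + om (h z) (dd z)" for z
  define Fr where "Fr z = G z * Gr z / (2 * (W z)\<^sup>2) - (G z)\<^sup>2 * Wr z / (2 * (W z) ^ 3)" for z
  have F: "F r s = (G (r, s) / (2 * W (r, s)))\<^sup>2" for r s
    by (simp add: F_def G_def W_def)
  have W0: "W z \<noteq> 0" if "z \<in> B" for z
    using nz that by (simp add: W_def B_def)
  have hB: "h z \<in> U" if "z \<in> B" for z
    using hU that by (simp add: B_def)
  have contG: "continuous_on B G" and contW: "continuous_on B W"
    unfolding G_def W_def ds_def
    by (auto intro!: G.continuous O.continuous cont_h cont1 hB)
  have contGr: "continuous_on B Gr" and contWr: "continuous_on B Wr"
    unfolding Gr_def Wr_def ds_def dr_def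
    by (auto intro!: continuous_intros G.continuous O.continuous G.continuous_frechet O.continuous_frechet
        cont_h cont1 cont2 hB)
  have contF: "continuous_on B (\<lambda>z. (G z / (2 * W z))\<^sup>2)"
    by (intro continuous_intros contG contW) (use W0 in auto)
  have contFr: "continuous_on B Fr"
    unfolding Fr_def by (intro continuous_intros contG contW contGr contWr) (use W0 in auto)
  show int: "F r integrable_on {c..d}" if "r \<in> {-\<delta>..\<delta>}" for r
    using slice[OF contF that] by (simp add: F[abs_def] integrable_continuous_real)
  have derF: "((\<lambda>r. F r s) has_real_derivative Fr (r, s)) (at r within {-\<delta>..\<delta>})"
    if rs: "r \<in> {-\<delta>..\<delta>}" "s \<in> {c..d}" for r s
  proof -
    have *: "((\<lambda>r. h (r, s)) has_vector_derivative dr (r, s)) (at r within {-\<delta>..\<delta>})"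
      "((\<lambda>r. ds (r, s)) has_vector_derivative dd (r, s)) (at r within {-\<delta>..\<delta>})"
      unfolding dr_def ds_def dd_def
      by (rule has_vector_derivative_partial[OF h] has_vector_derivative_partial[OF h1]; use rs box in auto)+
    have G': "((\<lambda>r. G (r, s)) has_real_derivative Gr (r, s)) (at r within {-\<delta>..\<delta>})"
      unfolding G_def Gr_def
      by (rule DERIV_cong[OF G.has_derivative[OF rs(1) *(1) *(2) *(2)]]) (use hU rs G.sym in auto)
    have W': "((\<lambda>r. W (r, s)) has_real_derivative Wr (r, s)) (at r within {-\<delta>..\<delta>})"
      unfolding W_def Wr_def
      by (rule O.has_derivative[OF rs(1) *]) (use hU rs in auto)
    have "W (r, s) \<noteq> 0" using W0 rs by (simp add: B_def)
    then show ?thesis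
      unfolding F Fr_def
      by (auto intro!: derivative_eq_intros G' W' simp: field_simps power2_eq_square power3_eq_cube)
  qed
  have "((\<lambda>r. integral (cbox c d) (F r)) has_real_derivative integral (cbox c d) (\<lambda>s. Fr (0, s)))
      (at 0 within {-\<delta>..\<delta>})"
    by (rule leibniz_rule_field_derivative[of _ _ _ _ "\<lambda>r s. Fr (r, s)"])
      (use derF int contFr \<open>\<delta> > 0\<close> in \<open>auto simp: B_def\<close>)
  moreover have "at 0 within {-\<delta>..\<delta>} = (at 0 :: real filter)"
    by (rule at_within_interior) (use \<open>\<delta> > 0\<close> in auto)
  moreover have "((\<lambda>s. Fr (0, s)) has_integral
      boundary_term T m (h (0, d)) (dr (0, d)) - boundary_term T m (h (0, c)) (dr (0, c))) {c..d}"
  proof (rule fundamental_theorem_of_calculus[OF \<open>c \<le> d\<close>], unfold has_real_derivative_iff_has_vector_derivative[symmetric])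
    fix s assume s: "s \<in> {c..d}"
    let ?x = "h (0, s)" and ?V = "dr (0, s)" and ?N = "dd (0, s)"
    let ?y = "y ?x" and ?Dy = "frechet_derivative y (at ?x)"
    have zs: "(0, s) \<in> B" using s \<open>\<delta> > 0\<close> by (auto simp: B_def)
    have xU: "?x \<in> U" using hU zs by (simp add: B_def)
    have hx: "((\<lambda>s. h (0, s)) has_vector_derivative T *\<^sub>R ?y) (at s within {c..d})"
      using has_vector_derivative_partial(2)[OF h subsetD[OF box zs[unfolded B_def]]] flow[OF s]
      by (simp add: ds_def)
    \<comment> \<open>Here the order of differentiation is exchanged: the
      \<open>s\<close>-derivative of the variation field is the \<open>r\<close>-derivative of the
      velocity.\<close>
    have V: "((\<lambda>s. dr (0, s)) has_vector_derivative ?N) (at s within {c..d})"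
      unfolding dr_def dd_def ds_def by (rule mixed_partials[OF h box \<open>\<delta> > 0\<close> s])
    have U': "h (0, \<tau>) \<in> U" if "\<tau> \<in> {c..d}" for \<tau>
      using hU that \<open>\<delta> > 0\<close> by auto
    note linG = linear_scale[OF G.lin1[OF xU]] linear_scale[OF G.lin2[OF xU]]
    note linO = linear_scale[OF O.lin[OF xU]]
    have sy: "((\<lambda>s. y (h (0, s))) has_vector_derivative T *\<^sub>R ?Dy ?y) (at s within {c..d})"
      using y_along[OF s hx U'] linear_scale[OF has_derivative_linear[OF Ck_on_has_derivative[OF y xU]]] by simp
    have Dg: "((\<lambda>s. gg (h (0, s)) (y (h (0, s))) (dr (0, s))) has_real_derivative
        gg ?x ?y ?N - T * gg ?x ?y (?Dy ?V)) (at s within {c..d})"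
    proof (rule DERIV_cong[OF G.has_derivative[OF s hx sy V U']])
      \<comment> \<open>In \<open>killing\<close> with \<open>u = y\<close> and
        \<open>w = V\<close>, the term containing \<open>Dy y\<close> cancels the contribution of
        the change of \<open>y\<close> along the orbit.\<close>
      have k: "frechet_derivative (\<lambda>p. gg p ?y ?V) (at ?x) ?y = - gg ?x (?Dy ?y) ?V - gg ?x ?y (?Dy ?V)"
        using killing[OF xU, of ?y ?V] by simp
      show "frechet_derivative (\<lambda>p. gg p ?y ?V) (at ?x) (T *\<^sub>R ?y) + gg ?x (T *\<^sub>R ?Dy ?y) ?V + gg ?x ?y ?N
          = gg ?x ?y ?N - T * gg ?x ?y (?Dy ?V)"
        by (simp add: G.left.frechet_scale[OF xU] linG k) (simp add: algebra_simps)
    qed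
    have Do: "((\<lambda>s. om (h (0, s)) (dr (0, s))) has_real_derivative
        om ?x ?N - T * om ?x (?Dy ?V)) (at s within {c..d})"
    proof (rule DERIV_cong[OF O.has_derivative[OF s hx V U']])
      have "frechet_derivative (\<lambda>p. om p ?V) (at ?x) ?y = - om ?x (?Dy ?V)"
        using lie[OF xU, of ?V] by simp
      then show "frechet_derivative (\<lambda>p. om p ?V) (at ?x) (T *\<^sub>R ?y) + om ?x ?N = om ?x ?N - T * om ?x (?Dy ?V)"
        by (simp add: O.frechet_scale[OF xU])
    qed
    \<comment> \<open>Constant length turns the derivative of \<open>gg\<close> along
      \<open>V\<close> into \<open>- 2 gg y (Dy V)\<close>, so that \<open>Gr\<close> is
      \<open>2 T\<close> times the derivative in \<open>Dg\<close>. In the same way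
      \<open>crit\<close> makes \<open>Wr\<close> equal to the derivative in
      \<open>Do\<close>.\<close>
    have Gr: "Gr (0, s) = 2 * T * (gg ?x ?y ?N - T * gg ?x ?y (?Dy ?V))"
    proof -
      have "frechet_derivative (\<lambda>p. gg p ?y ?y) (at ?x) ?V = - 2 * gg ?x ?y (?Dy ?V)"
        using length_deriv[OF xU, of ?V] by simp
      then show ?thesis
        using flow[OF s] by (simp add: Gr_def G.left.frechet_scale[OF xU] G.right.frechet_scale[OF xU] linG algebra_simps)
    qed
    have Wr: "Wr (0, s) = om ?x ?N - T * om ?x (?Dy ?V)"
    proof -
      have "frechet_derivative (\<lambda>p. om p ?y) (at ?x) ?V = - om ?x (?Dy ?V)"
        using crit[OF s, of ?V] by simp
      then show ?thesis
        using flow[OF s] by (simp add: Wr_def O.frechet_scale[OF xU])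
    qed
    \<comment> \<open>Both values are constant in \<open>s\<close>. With them the factors
      \<open>2 T G / (2 W^2)\<close> and \<open>G^2 / (2 W^3)\<close> occurring in \<open>Fr\<close>
      become \<open>T \<kappa> / m^2\<close> and \<open>T \<kappa>^2 / (2 m^3)\<close>, the
      coefficients of \<open>boundary_term\<close>.\<close>
    have GW: "G (0, s) = T\<^sup>2 * \<kappa>" "W (0, s) = T * m"
      using flow[OF s] m[OF s] length[OF xU] by (simp_all add: G_def W_def linG linO power2_eq_square)
    have "T \<noteq> 0" "m \<noteq> 0" using W0[OF zs] GW by auto
    then have "T * \<kappa> / m\<^sup>2 * (gg ?x ?y ?N - T * gg ?x ?y (?Dy ?V))
        - T * \<kappa>\<^sup>2 / (2 * m ^ 3) * (om ?x ?N - T * om ?x (?Dy ?V)) = Fr (0, s)"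
      unfolding Fr_def GW Gr Wr by (simp add: field_simps power2_eq_square power3_eq_cube)
    moreover have "((\<lambda>s. boundary_term T m (h (0, s)) (dr (0, s))) has_real_derivative
        T * \<kappa> / m\<^sup>2 * (gg ?x ?y ?N - T * gg ?x ?y (?Dy ?V))
        - T * \<kappa>\<^sup>2 / (2 * m ^ 3) * (om ?x ?N - T * om ?x (?Dy ?V))) (at s within {c..d})"
      unfolding boundary_term_def by (intro DERIV_diff DERIV_cmult Dg Do)
    ultimately show "((\<lambda>s. boundary_term T m (h (0, s)) (dr (0, s))) has_real_derivative Fr (0, s)) (at s within {c..d})"
      by simp
  qed
  ultimately show "((\<lambda>r. integral {c..d} (F r)) has_real_derivative
           boundary_term T m (h (0, d)) (dr (0, d)) - boundary_term T m (h (0, c)) (dr (0, c))) (at 0)"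
    by (simp add: integral_unique)
qed

end


section \<open>Charts and tangent vectors\<close>

locale manifold =
  fixes X :: "'a topology" and A :: "('a, 'e::euclidean_space) chart set"
  assumes manifold: "smooth_manifold X A"
begin

lemma is_chart: "c \<in> A \<Longrightarrow> is_chart X c"
  using manifold by (simp add: smooth_manifold_def smooth_atlas_def)

lemma chart_subset: "c \<in> A \<Longrightarrow> fst c \<subseteq> topspace X"
  using is_chart[of c] by (auto simp: is_chart_def dest: openin_subset)

lemma charts_at_nonempty: "p \<in> topspace X \<Longrightarrow> \<exists>c. c \<in> charts_at A p"
  using manifold unfolding smooth_manifold_def smooth_atlas_def charts_at_def by blast

lemma chart_homeo: "c \<in> A \<Longrightarrow> homeomorphic_map (subtopology X (fst c)) (top_of_set (snd c ` fst c)) (snd c)"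
  using is_chart[of c] by (simp add: is_chart_def)

lemma chart_inj: "c \<in> A \<Longrightarrow> inj_on (snd c) (fst c)"
  using homeomorphic_imp_injective_map[OF chart_homeo] chart_subset by (simp add: Int_absorb1)

lemma chart_inv [simp]: "c \<in> A \<Longrightarrow> p \<in> fst c \<Longrightarrow> chart_inv c (snd c p) = p"
  by (simp add: chart_inv_def chart_inj)

lemma chart_inv_in: "x \<in> snd c ` fst c \<Longrightarrow> chart_inv c x \<in> fst c"
  by (simp add: chart_inv_def inv_into_into)

lemma chart_chart_inv: "x \<in> snd c ` fst c \<Longrightarrow> snd c (chart_inv c x) = x"
  by (simp add: chart_inv_def f_inv_into_f)

lemma open_chart: "c \<in> A \<Longrightarrow> open (snd c ` fst c)"
  using is_chart[of c] by (simp add: is_chart_def)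

lemma openin_chart: "c \<in> A \<Longrightarrow> openin X (fst c)"
  using is_chart[of c] by (simp add: is_chart_def)

lemma open_chart_image:
  assumes "c \<in> A" "openin X V"
  shows "open (snd c ` (fst c \<inter> V))"
proof -
  have "openin (subtopology X (fst c)) (fst c \<inter> V)"
    using assms(2) by (rule openin_subtopology_Int2)
  then have "openin (top_of_set (snd c ` fst c)) (snd c ` (fst c \<inter> V))"
    using homeomorphic_imp_open_map[OF chart_homeo[OF assms(1)]] by (simp add: open_map_def)
  then show ?thesis
    using open_chart[OF assms(1)] openin_open_trans by blast
qed

lemma transition_chart: "c \<in> A \<Longrightarrow> p \<in> fst c \<Longrightarrow> transition c d (snd c p) = snd d p"
  by (simp add: transition_def)

lemma transition_has_derivative:
  assumes "c \<in> charts_at A p" "d \<in> charts_at A p"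
  shows "(transition c d has_derivative frechet_derivative (transition c d) (at (snd c p))) (at (snd c p))"
proof (rule Ck_on_has_derivative)
  have "smooth_on (snd c ` (fst c \<inter> fst d)) (transition c d)"
    using assms manifold by (auto simp: charts_at_def smooth_manifold_def smooth_atlas_def)
  then show "Ck_on (Suc 0) (transition c d) (snd c ` (fst c \<inter> fst d))"
    unfolding smooth_on_def by blast
qed (use assms in \<open>auto simp: charts_at_def\<close>)

lemma open_overlap: "c \<in> A \<Longrightarrow> d \<in> A \<Longrightarrow> open (snd c ` (fst c \<inter> fst d))"
  by (rule open_chart_image) (auto intro: openin_chart)

text \<open>The identity \<open>transition c e = transition d e \<circ> transition c d\<close>,
  valid on the open overlap of \<open>c\<close> and \<open>d\<close>, is differentiated. This
  cocycle rule is the compatibility that \<open>tangent_space\<close> demands of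
  \<open>coord_vec\<close>.\<close>

lemma frechet_transition_chain:
  assumes c: "c \<in> charts_at A p" and d: "d \<in> charts_at A p" and e: "e \<in> charts_at A p"
  shows "frechet_derivative (transition c e) (at (snd c p)) u =
    frechet_derivative (transition d e) (at (snd d p)) (frechet_derivative (transition c d) (at (snd c p)) u)"
proof -
  have p: "transition c d (snd c p) = snd d p"
    using c by (simp add: charts_at_def transition_chart)
  have "((\<lambda>x. transition d e (transition c d x)) has_derivative
      (\<lambda>u. frechet_derivative (transition d e) (at (snd d p)) (frechet_derivative (transition c d) (at (snd c p)) u)))
      (at (snd c p))"
    by (rule has_derivative_compose[OF transition_has_derivative[OF c d]])
      (use transition_has_derivative[OF d e] in \<open>simp add: p\<close>)
  then have "(transition c e has_derivative
      (\<lambda>u. frechet_derivative (transition d e) (at (snd d p)) (frechet_derivative (transition c d) (at (snd c p)) u)))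
      (at (snd c p))"
    by (rule has_derivative_transform_within_open[OF _ open_overlap[of c d]])
      (use c d in \<open>auto simp: charts_at_def transition_chart\<close>)
  then show ?thesis
    by (metis frechet_derivative_at)
qed

lemma coord_vec_tangent: "c \<in> charts_at A p \<Longrightarrow> coord_vec A c p u \<in> tangent_space A p"
  unfolding tangent_space_def coord_vec_def
  by (simp add: frechet_transition_chain[of c p d e for d e, symmetric])

lemma coord_vec_of_tangent:
  assumes c: "c \<in> charts_at A p" and v: "v \<in> tangent_space A p"
  shows "coord_vec A c p (v c) = v"
proof
  fix d
  show "coord_vec A c p (v c) d = v d"
  proof (cases "d \<in> charts_at A p")
    case True
    then have "v d = frechet_derivative (transition c d) (at (snd c p)) (v c)"
      using v c unfolding tangent_space_def by blast
    then show ?thesis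
      by (simp only: coord_vec_def True if_True)
  next
    case False
    then have "v d = 0" using v unfolding tangent_space_def by blast
    then show ?thesis by (simp only: coord_vec_def False if_False)
  qed
qed

lemma coord_vec_comb:
  assumes "c \<in> charts_at A p"
  shows "coord_vec A c p (a *\<^sub>R u + b *\<^sub>R w) = tlin a (coord_vec A c p u) b (coord_vec A c p w)"
proof
  fix d
  show "coord_vec A c p (a *\<^sub>R u + b *\<^sub>R w) d = tlin a (coord_vec A c p u) b (coord_vec A c p w) d"
  proof (cases "d \<in> charts_at A p")
    case True
    note linear = has_derivative_linear[OF transition_has_derivative[OF assms True]]
    show ?thesis
      using True by (simp add: coord_vec_def tlin_def linear_add[OF linear] linear_scale[OF linear])
  qed (simp add: coord_vec_def tlin_def)
qed

lemma chart_mem_overlapD: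
  assumes "c \<in> A" "q \<in> fst c" "snd c q \<in> snd c ` (fst c \<inter> V)"
  shows "q \<in> V"
  using assms inj_on_image_mem_iff[OF chart_inj[OF assms(1)], of q "fst c \<inter> V"] by auto

text \<open>The chain rule for the transition map. The condition \<open>ev\<close> is there because
  values of \<open>snd c\<close> outside \<open>fst c\<close> are meaningless, so
  \<open>transition c d (snd c (f \<tau>)) = snd d (f \<tau>)\<close> is guaranteed only while
  \<open>f \<tau>\<close> lies in \<open>fst c\<close>.\<close>

lemma has_vector_derivative_in_charts:
  assumes c: "c \<in> charts_at A (f t)" and d: "d \<in> charts_at A (f t)"
    and f: "((\<lambda>\<tau>. snd c (f \<tau>)) has_vector_derivative v) (at t within S)"
    and ev: "\<forall>\<^sub>F \<tau> in at t within S. f \<tau> \<in> fst c"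
  shows "((\<lambda>\<tau>. snd d (f \<tau>)) has_vector_derivative coord_vec A c (f t) v d) (at t within S)"
proof -
  have cA: "c \<in> A" "f t \<in> fst c" and dA: "d \<in> A" "f t \<in> fst d"
    using c d by (auto simp: charts_at_def)
  let ?D = "frechet_derivative (transition c d) (at (snd c (f t)))"
  note D = transition_has_derivative[OF c d]
  have "((\<lambda>\<tau>. transition c d (snd c (f \<tau>))) has_derivative (\<lambda>h. ?D (h *\<^sub>R v))) (at t within S)"
    using f unfolding has_vector_derivative_def
    by (rule has_derivative_compose[where g="transition c d" and g'="?D"]) (rule D)
  then have 1: "((\<lambda>\<tau>. transition c d (snd c (f \<tau>))) has_vector_derivative ?D v) (at t within S)"
    by (simp add: has_vector_derivative_def linear_scale[OF has_derivative_linear[OF D]])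
  have "((\<lambda>\<tau>. snd c (f \<tau>)) \<longlongrightarrow> snd c (f t)) (at t within S)"
    using has_vector_derivative_continuous[OF f] by (simp add: continuous_within)
  then have "\<forall>\<^sub>F \<tau> in at t within S. snd c (f \<tau>) \<in> snd c ` (fst c \<inter> fst d)"
    by (rule topological_tendstoD) (use cA dA in \<open>auto intro: open_overlap\<close>)
  with ev have "\<forall>\<^sub>F \<tau> in at t within S. transition c d (snd c (f \<tau>)) = snd d (f \<tau>)"
    by eventually_elim (use cA in \<open>auto simp: transition_chart\<close>)
  moreover have "transition c d (snd c (f t)) = snd d (f t)"
    using cA by (simp add: transition_chart)
  ultimately have "((\<lambda>\<tau>. snd d (f \<tau>)) has_vector_derivative ?D v) (at t within S)"
    using 1 unfolding has_vector_derivative_def has_derivative_within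
    by (auto elim!: Lim_transform_eventually eventually_mono)
  then show ?thesis using d by (simp add: coord_vec_def)
qed

text \<open>A derivative in one chart determines the entries in all others. The condition
  \<open>nb\<close> makes vector derivatives unique, so that \<open>vector_derivative\<close>
  returns the expected value.\<close>

lemma velocity_eq_coord_vec:
  assumes c: "c \<in> charts_at A (f t)"
    and f: "((\<lambda>\<tau>. snd c (f \<tau>)) has_vector_derivative v) (at t within S)"
    and ev: "\<forall>\<^sub>F \<tau> in at t within S. f \<tau> \<in> fst c" and nb: "at t within S \<noteq> bot"
  shows "velocity A f t (at t within S) = coord_vec A c (f t) v"
proof
  fix d
  show "velocity A f t (at t within S) d = coord_vec A c (f t) v d"
  proof (cases "d \<in> charts_at A (f t)")
    case True
    then show ?thesis
      using vector_derivative_within[OF nb has_vector_derivative_in_charts[OF c True f ev]]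
      by (simp add: velocity_def o_def)
  qed (simp add: velocity_def coord_vec_def)
qed

lemma smooth_into_imp_continuous_map:
  assumes "smooth_into A D F"
  shows "continuous_map (top_of_set D) X F"
  unfolding continuous_map_def
proof (intro conjI allI impI)
  show "F \<in> topspace (top_of_set D) \<rightarrow> topspace X"
    using assms chart_subset by (fastforce simp: smooth_into_def)
  fix V assume V: "openin X V"
  show "openin (top_of_set D) {x \<in> topspace (top_of_set D). F x \<in> V}"
    unfolding topspace_euclidean_subtopology
  proof (subst openin_subopen, safe)
    fix x assume x: "x \<in> D" "F x \<in> V"
    obtain c W h where c: "c \<in> A" and W: "open W" "x \<in> W" and h: "smooth_on W h"
      and F: "\<And>y. y \<in> W \<inter> D \<Longrightarrow> F y \<in> fst c \<and> snd c (F y) = h y"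
      using assms x unfolding smooth_into_def by metis
    have "continuous_on W h"
      using h unfolding smooth_on_def by (metis Ck_on.simps(1))
    then have "open (W \<inter> h -` (snd c ` (fst c \<inter> V)))"
      using W open_chart_image[OF c V] by (simp add: continuous_on_open_vimage Int_commute)
    then have "openin (top_of_set D) (D \<inter> (W \<inter> h -` (snd c ` (fst c \<inter> V))))"
      by (rule openin_open_Int)
    moreover have "x \<in> D \<inter> (W \<inter> h -` (snd c ` (fst c \<inter> V)))"
      using x W F[of x] by (auto intro!: image_eqI[of _ _ "F x"])
    moreover have "D \<inter> (W \<inter> h -` (snd c ` (fst c \<inter> V))) \<subseteq> {x \<in> D. F x \<in> V}"
      using F chart_mem_overlapD[OF c] by fastforce
    ultimately show "\<exists>T. openin (top_of_set D) T \<and> x \<in> T \<and> T \<subseteq> {x \<in> D. F x \<in> V}"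
      by blast
  qed
qed

end


section \<open>Coordinate expressions\<close>

locale killing_data = manifold X A
  for X :: "'a topology" and A :: "('a, 'e::euclidean_space) chart set" +
  fixes g :: "'a \<Rightarrow> ('a, 'e) tvec \<Rightarrow> ('a, 'e) tvec \<Rightarrow> real"
    and \<omega> :: "'a \<Rightarrow> ('a, 'e) tvec \<Rightarrow> real"
    and Y :: "'a \<Rightarrow> ('a, 'e) tvec"
    and \<kappa> :: real
  assumes metric: "riemannian_metric X A g"
    and killing: "killing_field X A g Y"
    and length: "p \<in> topspace X \<Longrightarrow> g p (Y p) (Y p) = \<kappa>"
    and form: "smooth_one_form X A \<omega>"
    and negative: "p \<in> topspace X \<Longrightarrow> \<omega> p (Y p) < 0"
    and invariant: "lie_invariant_form X A Y \<omega>"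
begin

definition local_metric :: "('a, 'e) chart \<Rightarrow> 'e \<Rightarrow> 'e \<Rightarrow> 'e \<Rightarrow> real" where
  "local_metric c x u w = g (chart_inv c x) (coord_vec A c (chart_inv c x) u) (coord_vec A c (chart_inv c x) w)"

definition local_form :: "('a, 'e) chart \<Rightarrow> 'e \<Rightarrow> 'e \<Rightarrow> real" where
  "local_form c x u = \<omega> (chart_inv c x) (coord_vec A c (chart_inv c x) u)"

definition local_field :: "('a, 'e) chart \<Rightarrow> 'e \<Rightarrow> 'e" where
  "local_field c x = Y (chart_inv c x) c"

lemma charts_at_chart_inv: "c \<in> A \<Longrightarrow> x \<in> snd c ` fst c \<Longrightarrow> c \<in> charts_at A (chart_inv c x)"
  by (simp add: charts_at_def chart_inv_in)

lemma field_tangent: "p \<in> topspace X \<Longrightarrow> Y p \<in> tangent_space A p"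
  using killing by (simp add: killing_field_def smooth_vector_field_def)

lemma charts_at_topspace: "c \<in> charts_at A p \<Longrightarrow> p \<in> topspace X"
  using chart_subset[of c] by (auto simp: charts_at_def)

lemma form_comb:
  "p \<in> topspace X \<Longrightarrow> v \<in> tangent_space A p \<Longrightarrow> w \<in> tangent_space A p \<Longrightarrow>
     \<omega> p (tlin a v b w) = a * \<omega> p v + b * \<omega> p w"
  using form by (simp add: smooth_one_form_def)

lemma coord_vec_field: "c \<in> charts_at A p \<Longrightarrow> coord_vec A c p (Y p c) = Y p"
  by (simp add: coord_vec_of_tangent field_tangent charts_at_topspace)

lemma local_form_field:
  assumes "c \<in> A" "x \<in> snd c ` fst c"
  shows "local_form c x (local_field c x) = \<omega> (chart_inv c x) (Y (chart_inv c x))"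
  using assms by (simp add: local_form_def local_field_def coord_vec_field charts_at_chart_inv)

lemma local_form_linear:
  assumes c: "c \<in> A" and x: "x \<in> snd c ` fst c"
  shows "linear (local_form c x)"
proof -
  note ca = charts_at_chart_inv[OF c x]
  have comb: "local_form c x (a *\<^sub>R u + b *\<^sub>R w) = a * local_form c x u + b * local_form c x w" for a b u w
    unfolding local_form_def coord_vec_comb[OF ca]
    by (intro form_comb coord_vec_tangent[OF ca] charts_at_topspace[OF ca])
  show ?thesis
    using comb[of 1 _ 1] comb[of _ _ 0 0] by (intro linearI) simp_all
qed

lemma local_metric_linear:
  assumes c: "c \<in> A" and x: "x \<in> snd c ` fst c"
  shows "linear (\<lambda>u. local_metric c x u w)"
proof -
  note ca = charts_at_chart_inv[OF c x]
  have comb: "local_metric c x (a *\<^sub>R u + b *\<^sub>R v) w = a * local_metric c x u w + b * local_metric c x v w" for a b u v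
    unfolding local_metric_def coord_vec_comb[OF ca]
    using metric coord_vec_tangent[OF ca] charts_at_topspace[OF ca] by (simp add: riemannian_metric_def)
  show ?thesis
    using comb[of 1 _ 1] comb[of _ _ 0 0] by (intro linearI) simp_all
qed

lemma killing_chart:
  assumes c: "c \<in> A"
  shows "killing_chart (snd c ` fst c) (local_metric c) (local_form c) (local_field c) \<kappa>"
proof -
  let ?U = "snd c ` fst c"
  show ?thesis
  proof (intro killing_chart.intro C1_bilinear.intro C1_form.intro killing_chart_axioms.intro)
    show "open ?U" by (rule open_chart[OF c])
    then show "open ?U" .
    show "linear (local_form c x)" if "x \<in> ?U" for x
      by (rule local_form_linear[OF c that])
    show "linear (\<lambda>u. local_metric c x u w)" if "x \<in> ?U" for x w
      by (rule local_metric_linear[OF c that])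
    show "Ck_on (Suc 0) (\<lambda>x. local_form c x u) ?U" for u
      using form c unfolding smooth_one_form_def smooth_on_def local_form_def by blast
    show "Ck_on (Suc 0) (\<lambda>x. local_metric c x u w) ?U" for u w
      using metric c unfolding riemannian_metric_def smooth_on_def local_metric_def by blast
    show "Ck_on (Suc 0) (local_field c) ?U"
      using killing c unfolding killing_field_def smooth_vector_field_def smooth_on_def local_field_def by blast
  next
    fix x u w assume x: "x \<in> ?U"
    note ca = charts_at_chart_inv[OF c x]
    have sym: "local_metric c x u w = local_metric c x w u" for u w
      using metric charts_at_topspace[OF ca] coord_vec_tangent[OF ca]
      by (simp add: riemannian_metric_def local_metric_def)
    then show "local_metric c x u w = local_metric c x w u" .
    \<comment> \<open>The brackets in the Lie derivatives carry \<open>- D_u Y\<close>; linearity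
      moves the sign out.\<close>
    note negm = linear_neg[OF local_metric_linear[OF c x]]
    have "lie_deriv_metric A Y g c (chart_inv c x) u w = 0"
      using killing ca charts_at_topspace[OF ca] by (simp add: killing_field_def)
    then have "frechet_derivative (\<lambda>x. local_metric c x u w) (at x) (local_field c x)
        - local_metric c x (- frechet_derivative (local_field c) (at x) u) w
        - local_metric c x u (- frechet_derivative (local_field c) (at x) w) = 0"
      by (simp add: lie_deriv_metric_def deriv_along_def bracket_coord_def chart_chart_inv[OF x]
          local_metric_def[abs_def] local_field_def[abs_def])
    then show "frechet_derivative (\<lambda>x. local_metric c x u w) (at x) (local_field c x)
        + local_metric c x (frechet_derivative (local_field c) (at x) u) w
        + local_metric c x u (frechet_derivative (local_field c) (at x) w) = 0"
      by (simp add: negm sym[of u])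
    have "lie_deriv_form A Y \<omega> c (chart_inv c x) u = 0"
      using invariant ca charts_at_topspace[OF ca] by (simp add: lie_invariant_form_def)
    then have "frechet_derivative (\<lambda>x. local_form c x u) (at x) (local_field c x)
        - local_form c x (- frechet_derivative (local_field c) (at x) u) = 0"
      by (simp add: lie_deriv_form_def deriv_along_def bracket_coord_def chart_chart_inv[OF x]
          local_form_def[abs_def] local_field_def[abs_def])
    then show "frechet_derivative (\<lambda>x. local_form c x u) (at x) (local_field c x)
        + local_form c x (frechet_derivative (local_field c) (at x) u) = 0"
      by (simp add: linear_neg[OF local_form_linear[OF c x]])
    show "local_metric c x (local_field c x) (local_field c x) = \<kappa>"
      using length[OF charts_at_topspace[OF ca]] by (simp add: local_metric_def local_field_def coord_vec_field[OF ca])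
  qed
qed

text \<open>Continuity is local and charts are homeomorphisms, so it is inherited from the
  coordinate expression. It yields the extrema of \<open>\<omega>(Y)\<close> on a compact
  manifold.\<close>

lemma continuous_form_field: "continuous_map X euclideanreal (\<lambda>p. \<omega> p (Y p))"
  unfolding continuous_map_def
proof (intro conjI allI impI)
  fix V :: "real set" assume "openin euclideanreal V"
  then have V: "open V" by simp
  show "openin X {p \<in> topspace X. \<omega> p (Y p) \<in> V}"
  proof (subst openin_subopen, safe)
    fix p assume p: "p \<in> topspace X" "\<omega> p (Y p) \<in> V"
    then obtain c where ca: "c \<in> charts_at A p" using charts_at_nonempty by blast
    then have c: "c \<in> A" "p \<in> fst c" by (auto simp: charts_at_def)
    let ?U = "snd c ` fst c"
    interpret killing_chart ?U "local_metric c" "local_form c" "local_field c" \<kappa>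
      by (rule killing_chart[OF c(1)])
    have "continuous_on ?U (\<lambda>x. local_form c x (local_field c x))"
      by (rule O.continuous) (use Ck_on_SucD[OF y] in auto)
    then have "open {x \<in> ?U. local_form c x (local_field c x) \<in> V}"
      using continuous_on_open_vimage[OF open_chart[OF c(1)], of "\<lambda>x. local_form c x (local_field c x)"] V
      by (simp add: vimage_def Int_def conj_commute)
    then have "openin (subtopology X (fst c)) {q \<in> topspace (subtopology X (fst c)).
        snd c q \<in> {x \<in> ?U. local_form c x (local_field c x) \<in> V}}"
      by (intro openin_continuous_map_preimage[OF homeomorphic_imp_continuous_map[OF chart_homeo[OF c(1)]]])
        (auto intro: open_subset)
    then have "openin X {q \<in> topspace (subtopology X (fst c)).
        snd c q \<in> {x \<in> ?U. local_form c x (local_field c x) \<in> V}}"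
      using openin_chart[OF c(1)] by (rule openin_trans_full)
    moreover have "{q \<in> topspace (subtopology X (fst c)). snd c q \<in> {x \<in> ?U. local_form c x (local_field c x) \<in> V}}
        = {q \<in> fst c. \<omega> q (Y q) \<in> V}"
      using c chart_subset[OF c(1)] by (auto simp: local_form_field inj_on_eq_iff[OF chart_inj[OF c(1)]])
    ultimately show "\<exists>T. openin X T \<and> p \<in> T \<and> T \<subseteq> {p \<in> topspace X. \<omega> p (Y p) \<in> V}"
      using c p chart_subset[OF c(1)] by (intro exI[of _ "{q \<in> fst c. \<omega> q (Y q) \<in> V}"]) auto
  qed
qed auto

end


section \<open>Closed orbits\<close>

locale closed_orbit = killing_data X A g \<omega> Y \<kappa>
  for X :: "'a topology" and A :: "('a, 'e::euclidean_space) chart set" and g \<omega> Y \<kappa> +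
  fixes \<gamma> :: "real \<Rightarrow> 'a" and T :: real
  assumes integral_curve: "integral_curve A Y \<gamma>"
    and T_pos: "T > 0"
    and periodic: "\<gamma> (t + T) = \<gamma> t"
begin

lemma orbit_chart:
  obtains c W where "c \<in> A" "open W" "t \<in> W" "\<And>\<tau>. \<tau> \<in> W \<Longrightarrow> \<gamma> \<tau> \<in> fst c"
  using integral_curve unfolding integral_curve_def smooth_into_def by (metis Int_UNIV_right UNIV_I)

lemma orbit_in_topspace: "\<gamma> t \<in> topspace X"
  by (rule orbit_chart[of t]) (use chart_subset in blast)

lemma orbit_derivative:
  "c \<in> charts_at A (\<gamma> t) \<Longrightarrow> ((\<lambda>\<tau>. snd c (\<gamma> \<tau>)) has_vector_derivative Y (\<gamma> t) c) (at t)"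
  using integral_curve by (simp add: integral_curve_def o_def)

lemma form_const: "\<omega> (\<gamma> t) (Y (\<gamma> t)) = \<omega> (\<gamma> s) (Y (\<gamma> s))"
proof (rule DERIV_isconst_all[where f="\<lambda>t. \<omega> (\<gamma> t) (Y (\<gamma> t))"], rule allI)
  fix t
  obtain c W where c: "c \<in> A" and W: "open W" "t \<in> W" and in_c: "\<And>\<tau>. \<tau> \<in> W \<Longrightarrow> \<gamma> \<tau> \<in> fst c"
    using orbit_chart[of t] by metis
  interpret killing_chart "snd c ` fst c" "local_metric c" "local_form c" "local_field c" \<kappa>
    by (rule killing_chart[OF c])
  have "((\<lambda>\<tau>. snd c (\<gamma> \<tau>)) has_vector_derivative local_field c (snd c (\<gamma> t))) (at t within W)"
    using orbit_derivative[of c t] in_c[OF W(2)] c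
    by (auto simp: charts_at_def local_field_def intro: has_vector_derivative_at_within)
  from diag_orbit[OF W(2) this] in_c
  have "((\<lambda>\<tau>. local_form c (snd c (\<gamma> \<tau>)) (local_field c (snd c (\<gamma> \<tau>)))) has_real_derivative 0) (at t)"
    using at_within_open[OF W(2,1)] by simp
  then show "((\<lambda>t. \<omega> (\<gamma> t) (Y (\<gamma> t))) has_real_derivative 0) (at t)"
    unfolding has_field_derivative_def
    by (rule has_derivative_transform_within_open[OF _ W])
      (use in_c c in \<open>auto simp: local_form_field\<close>)
qed

lemma periodic_int: "\<gamma> (t + of_int n * T) = \<gamma> t"
proof -
  have nat: "\<gamma> (t + of_nat k * T) = \<gamma> t" for k t
  proof (induction k)
    case (Suc k)
    then show ?case using periodic[of "t + of_nat k * T"] by (simp add: algebra_simps)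
  qed simp
  show ?thesis
  proof (cases "n \<ge> 0")
    case True
    then show ?thesis using nat[of t "nat n"] by simp
  next
    case False
    then show ?thesis using nat[of "t + of_int n * T" "nat (- n)"] by (simp add: algebra_simps)
  qed
qed

definition loop :: "real \<Rightarrow> 'a" where "loop s = \<gamma> (T * s)"

text \<open>The rescaled orbit is already 1-periodic on the whole line, so its one-sided velocities
  at 0 and 1 need no separate treatment.\<close>

lemma periodize_loop: "periodize loop = loop"
proof
  fix s
  show "periodize loop s = loop s"
    using periodic_int[of "T * s" "- \<lfloor>s\<rfloor>"] by (simp add: periodize_def loop_def frac_def algebra_simps)
qed

lemma loop_derivative:
  assumes "c \<in> charts_at A (loop s)"
  shows "((\<lambda>\<tau>. snd c (loop \<tau>)) has_vector_derivative T *\<^sub>R Y (loop s) c) (at s within S)"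
proof -
  have "((\<lambda>\<tau>. T * \<tau>) has_vector_derivative T) (at s within S)"
    by (auto intro!: derivative_eq_intros)
  moreover have "((\<lambda>\<tau>. snd c (\<gamma> \<tau>)) has_vector_derivative Y (loop s) c) (at (T * s) within (\<lambda>\<tau>. T * \<tau>) ` S)"
    using orbit_derivative[of c "T * s"] assms by (auto simp: loop_def intro: has_vector_derivative_at_within)
  ultimately show ?thesis
    using vector_diff_chain_within[of "\<lambda>\<tau>. T * \<tau>"] by (fastforce simp: loop_def o_def)
qed

text \<open>An arbitrary \<open>S\<close> handles left and right velocities at once.\<close>

lemma loop_velocity:
  assumes c: "c \<in> charts_at A (loop s)" and nb: "at s within S \<noteq> bot"
  shows "velocity A loop s (at s within S) = coord_vec A c (loop s) (T *\<^sub>R Y (loop s) c)"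
proof (rule velocity_eq_coord_vec[OF c loop_derivative[OF c] _ nb])
  have "continuous_map (top_of_set UNIV) X \<gamma>"
    using integral_curve unfolding integral_curve_def by (blast intro: smooth_into_imp_continuous_map)
  then have "open {t. \<gamma> t \<in> fst c}"
    using openin_continuous_map_preimage[of euclideanreal X \<gamma> "fst c"] openin_chart[of c] c
    by (simp add: charts_at_def)
  then have "open ((\<lambda>\<tau>. T * \<tau>) -` {t. \<gamma> t \<in> fst c})"
    by (intro open_vimage continuous_intros)
  then have "open {\<tau>. loop \<tau> \<in> fst c}" by (simp add: vimage_def loop_def)
  then show "\<forall>\<^sub>F \<tau> in at s within S. loop \<tau> \<in> fst c"
    using c by (auto simp: eventually_at_topological charts_at_def)
qed

lemma loop_velocity_dom:
  assumes nb: "at s within S \<noteq> bot"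
  shows "velocity A loop s (at s within S) \<in> kropina_dom A \<omega> (loop s)"
proof -
  have top: "loop s \<in> topspace X" by (simp add: loop_def orbit_in_topspace)
  then obtain c where c: "c \<in> charts_at A (loop s)" using charts_at_nonempty by blast
  \<comment> \<open>The multiple \<open>T Y\<close> is written as a \<open>tlin\<close> with second
    coefficient 0, the shape in which linearity of \<open>\<omega>\<close> is available.\<close>
  have "coord_vec A c (loop s) (T *\<^sub>R Y (loop s) c) = tlin T (Y (loop s)) 0 (Y (loop s))"
    using coord_vec_comb[OF c, of T "Y (loop s) c" 0 "Y (loop s) c"] by (simp add: coord_vec_field[OF c])
  then have "- \<omega> (loop s) (coord_vec A c (loop s) (T *\<^sub>R Y (loop s) c)) > 0"
    using negative[OF top] T_pos by (simp add: form_comb[OF top] field_tangent[OF top] mult_pos_neg)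
  then show ?thesis
    by (simp add: loop_velocity[OF c nb] kropina_dom_def coord_vec_tangent[OF c])
qed

lemma loop_in_Omega: "loop \<in> Omega X A \<omega>"
proof -
  have smooth: "smooth_into A {0..1} loop"
    unfolding smooth_into_def
  proof
    fix s :: real
    obtain c W h where c: "c \<in> A" and W: "open W" "T * s \<in> W" "smooth_on W h"
      and h: "\<And>\<tau>. \<tau> \<in> W \<Longrightarrow> \<gamma> \<tau> \<in> fst c \<and> snd c (\<gamma> \<tau>) = h \<tau>"
      using integral_curve unfolding integral_curve_def smooth_into_def by (metis Int_UNIV_right UNIV_I)
    have "open ((\<lambda>x. T *\<^sub>R x) -` W)"
      by (intro open_vimage W continuous_intros)
    moreover have "smooth_on ((\<lambda>x. T *\<^sub>R x) -` W) (\<lambda>x. h (T *\<^sub>R x))"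
      by (rule smooth_on_compose_scaleR[OF W(1,3)])
    ultimately show "\<exists>c\<in>A. \<exists>W h. open W \<and> s \<in> W \<and> smooth_on W h \<and>
        (\<forall>y\<in>W \<inter> {0..1}. loop y \<in> fst c \<and> snd c (loop y) = h y)"
      using c W(2) h by (intro bexI[OF _ c] exI conjI) (auto simp: loop_def)
  qed
  have "adjacent {0, 1} a b \<Longrightarrow> a = 0 \<and> b = 1" for a b
    by (auto simp: adjacent_def)
  then have "piecewise_smooth A loop"
    using smooth unfolding piecewise_smooth_def
    by (intro exI[of _ "{0, 1}"]) (auto simp: partition01_def)
  moreover have "loop 0 = loop 1"
    using periodic[of 0] by (simp add: loop_def)
  ultimately show ?thesis
    using smooth_into_imp_continuous_map[OF smooth] loop_velocity_dom
    by (auto simp: Omega_def left_velocity_def right_velocity_def periodize_loop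
        trivial_limit_at_left_real trivial_limit_at_right_real)
qed

text \<open>A constant loop has velocity 0, which forces \<open>Y = 0\<close> and hence
  \<open>\<omega>(Y) = 0\<close> at its point, against \<open>negative\<close>.\<close>

lemma loop_not_constant: "\<not> loop constant_on {0..1}"
proof
  assume "loop constant_on {0..1}"
  then obtain q where q: "\<And>s. s \<in> {0..1} \<Longrightarrow> loop s = q"
    by (auto simp: constant_on_def)
  have top: "loop 0 \<in> topspace X" by (simp add: loop_def orbit_in_topspace)
  then obtain c where c: "c \<in> charts_at A (loop 0)" using charts_at_nonempty by blast
  have "((\<lambda>\<tau>. snd c q) has_vector_derivative T *\<^sub>R Y (loop 0) c) (at 0 within {0..1})"
    by (rule has_vector_derivative_transform[OF _ _ loop_derivative[OF c]]) (use q in auto)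
  then have "T *\<^sub>R Y (loop 0) c = 0"
    by (rule vector_derivative_unique_within_closed_interval[of 0 1 0, unfolded box_real, rotated 2]) auto
  then have "Y (loop 0) c = 0" using T_pos by simp
  then have "Y (loop 0) = tlin 0 (Y (loop 0)) 0 (Y (loop 0))"
    using coord_vec_field[OF c] coord_vec_comb[OF c, of 0 "Y (loop 0) c" 0 "Y (loop 0) c"] by simp
  then have "\<omega> (loop 0) (Y (loop 0)) = 0"
    using form_comb[OF top] field_tangent[OF top] by (metis add_0 mult_zero_left)
  then show False using negative[OF top] by simp
qed

end


section \<open>Derivatives of integrals, piecewise\<close>

text \<open>At a point of \<open>P\<close> the cells on its two sides differ. This one contains a
  right neighbourhood of \<open>x\<close>, the one in \<open>adjacent_left\<close> a left
  neighbourhood.\<close>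

lemma adjacent_right:
  assumes "partition01 P" "0 \<le> x" "x < 1"
  obtains p q where "adjacent P p q" "p \<le> x" "x < q"
proof -
  have fin: "finite {u \<in> P. u \<le> x}" "finite {u \<in> P. x < u}"
    and ne: "{u \<in> P. u \<le> x} \<noteq> {}" "{u \<in> P. x < u} \<noteq> {}"
    using assms by (auto simp: partition01_def)
  let ?p = "Max {u \<in> P. u \<le> x}" and ?q = "Min {u \<in> P. x < u}"
  have "?p \<in> {u \<in> P. u \<le> x}" "?q \<in> {u \<in> P. x < u}"
    using fin ne Max_in Min_in by blast+
  moreover have "u \<le> ?p \<or> ?q \<le> u" if "u \<in> P" for u
    using that fin by (cases "u \<le> x") auto
  ultimately show ?thesis
    by (intro that[of ?p ?q]) (force simp: adjacent_def)+
qed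

lemma adjacent_left:
  assumes "partition01 P" "0 < x" "x \<le> 1"
  obtains p q where "adjacent P p q" "p < x" "x \<le> q"
proof -
  have fin: "finite {u \<in> P. u < x}" "finite {u \<in> P. x \<le> u}"
    and ne: "{u \<in> P. u < x} \<noteq> {}" "{u \<in> P. x \<le> u} \<noteq> {}"
    using assms by (auto simp: partition01_def)
  let ?p = "Max {u \<in> P. u < x}" and ?q = "Min {u \<in> P. x \<le> u}"
  have "?p \<in> {u \<in> P. u < x}" "?q \<in> {u \<in> P. x \<le> u}"
    using fin ne Max_in Min_in by blast+
  moreover have "u \<le> ?p \<or> ?q \<le> u" if "u \<in> P" for u
    using that fin by (cases "u < x") auto
  ultimately show ?thesis
    by (intro that[of ?p ?q]) (force simp: adjacent_def)+
qed

lemma periodize_eq: "\<gamma> 0 = \<gamma> 1 \<Longrightarrow> s \<in> {0..1} \<Longrightarrow> periodize \<gamma> s = \<gamma> s"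
  by (cases "s = 1") (auto simp: periodize_def frac_eq)

lemma open_contains_rectangle:
  fixes W :: "(real \<times> real) set"
  assumes "open W" "(r, s) \<in> W"
  obtains \<delta> where "\<delta> > 0" "{r-\<delta>..r+\<delta>} \<times> {s-\<delta>..s+\<delta>} \<subseteq> W"
proof -
  obtain B C where BC: "open B" "open C" "r \<in> B" "s \<in> C" "B \<times> C \<subseteq> W"
    using open_prod_elim[OF assms] by (metis mem_Sigma_iff)
  obtain b c where b: "b > 0" "cball r b \<subseteq> B" and c: "c > 0" "cball s c \<subseteq> C"
    using BC open_contains_cball by metis
  have "{r - min b c..r + min b c} \<subseteq> B" "{s - min b c..s + min b c} \<subseteq> C"
    using b c by (force simp: cball_eq_atLeastAtMost)+
  then show ?thesis
    using b c BC by (intro that[of "min b c"]) auto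
qed

text \<open>The additive form of the variation formula. Integrability for all \<open>r\<close> near
  0 is included because \<open>integral\<close> defaults to 0 on non-integrable functions, and
  integrals over adjacent intervals could then fail to add up.\<close>

definition has_integral_derivative :: "(real \<Rightarrow> real \<Rightarrow> real) \<Rightarrow> (real \<Rightarrow> real) \<Rightarrow> real \<Rightarrow> real \<Rightarrow> bool" where
  "has_integral_derivative F \<Phi> a b \<longleftrightarrow>
     (\<forall>\<^sub>F r in nhds 0. F r integrable_on {a..b}) \<and>
     ((\<lambda>r. integral {a..b} (F r)) has_real_derivative \<Phi> b - \<Phi> a) (at 0)"

lemma has_integral_derivative_refl: "has_integral_derivative F \<Phi> a a"
  using integrable_on_refl[of "_ :: real \<Rightarrow> real" a] by (simp add: has_integral_derivative_def)

lemma has_integral_derivative_trans: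
  assumes ab: "has_integral_derivative F \<Phi> a b" and bc: "has_integral_derivative F \<Phi> b c"
    and "a \<le> b" "b \<le> c"
  shows "has_integral_derivative F \<Phi> a c"
proof -
  have ev: "\<forall>\<^sub>F r in nhds 0. F r integrable_on {a..b} \<and> F r integrable_on {b..c}"
    using ab bc by (auto simp: has_integral_derivative_def eventually_conj_iff)
  then have "\<forall>\<^sub>F r in nhds 0. F r integrable_on {a..c}"
    by eventually_elim (use Henstock_Kurzweil_Integration.integrable_combine[OF \<open>a \<le> b\<close> \<open>b \<le> c\<close>] in blast)
  moreover from this have "\<forall>\<^sub>F r in nhds 0. integral {a..b} (F r) + integral {b..c} (F r) = integral {a..c} (F r)"
    by eventually_elim (use Henstock_Kurzweil_Integration.integral_combine[OF \<open>a \<le> b\<close> \<open>b \<le> c\<close>] in blast)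
  moreover have "((\<lambda>r. integral {a..b} (F r) + integral {b..c} (F r)) has_real_derivative
      (\<Phi> b - \<Phi> a) + (\<Phi> c - \<Phi> b)) (at 0)"
    using ab bc by (intro DERIV_add) (auto simp: has_integral_derivative_def)
  ultimately show ?thesis
    by (auto simp: has_integral_derivative_def DERIV_cong_ev[OF refl])
qed

text \<open>Compactness of \<open>[a,b]\<close> in the form of bisection. One-sided hypotheses
  suffice, as a short interval around \<open>x\<close> can be cut at \<open>x\<close>; they are all
  that is available at a partition point.\<close>

lemma has_integral_derivative_local:
  assumes "a \<le> b"
    and left: "\<And>x. a < x \<Longrightarrow> x \<le> b \<Longrightarrow> \<exists>\<delta>>0. \<forall>c<x. a \<le> c \<longrightarrow> x - c < \<delta> \<longrightarrow> has_integral_derivative F \<Phi> c x"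
    and right: "\<And>x. a \<le> x \<Longrightarrow> x < b \<Longrightarrow> \<exists>\<delta>>0. \<forall>d>x. d \<le> b \<longrightarrow> d - x < \<delta> \<longrightarrow> has_integral_derivative F \<Phi> x d"
  shows "has_integral_derivative F \<Phi> a b"
proof -
  \<comment> \<open>\<open>Bolzano\<close> quantifies over all \<open>c\<close> and
    \<open>d\<close>; the guards confine the property to subintervals of
    \<open>[a,b]\<close>.\<close>
  let ?P = "\<lambda>c d. a \<le> c \<longrightarrow> c \<le> d \<longrightarrow> d \<le> b \<longrightarrow> has_integral_derivative F \<Phi> c d"
  have "?P a b"
  proof (rule Bolzano[of a b ?P])
    show "a \<le> b" by fact
    show "?P u w" if "?P u v" "?P v w" "u \<le> v" "v \<le> w" for u v w
      using that has_integral_derivative_trans by (meson order_trans)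
    fix x assume x: "a \<le> x" "x \<le> b"
    obtain \<delta>1 where 1: "\<delta>1 > 0" "\<And>c. c < x \<Longrightarrow> a \<le> c \<Longrightarrow> x - c < \<delta>1 \<Longrightarrow> has_integral_derivative F \<Phi> c x"
      using left[of x] x by (cases "a = x") (auto intro: zero_less_one)
    obtain \<delta>2 where 2: "\<delta>2 > 0" "\<And>d. x < d \<Longrightarrow> d \<le> b \<Longrightarrow> d - x < \<delta>2 \<Longrightarrow> has_integral_derivative F \<Phi> x d"
      using right[of x] x by (cases "b = x") (auto intro: zero_less_one)
    show "\<exists>\<delta>>0. \<forall>c d. c \<le> x \<and> x \<le> d \<and> d - c < \<delta> \<longrightarrow> ?P c d"
    proof (intro exI[of _ "min \<delta>1 \<delta>2"] conjI allI impI)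
      fix c d assume cd: "c \<le> x \<and> x \<le> d \<and> d - c < min \<delta>1 \<delta>2" "a \<le> c" "c \<le> d" "d \<le> b"
      have "has_integral_derivative F \<Phi> c x"
        using 1(2)[of c] cd has_integral_derivative_refl by (cases "c = x") auto
      moreover have "has_integral_derivative F \<Phi> x d"
        using 2(2)[of d] cd has_integral_derivative_refl by (cases "d = x") auto
      ultimately show "has_integral_derivative F \<Phi> c d"
        using cd by (auto intro: has_integral_derivative_trans)
    qed (use 1 2 in auto)
  qed
  then show ?thesis using \<open>a \<le> b\<close> by simp
qed


section \<open>Orbits of extremal points are geodesics\<close>

locale extremal_orbit = closed_orbit X A g \<omega> Y \<kappa> \<gamma> T
  for X :: "'a topology" and A :: "('a, 'e::euclidean_space) chart set" and g \<omega> Y \<kappa> \<gamma> T +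
  assumes extremal: "(\<forall>q\<in>topspace X. \<omega> q (Y q) \<le> \<omega> (\<gamma> 0) (Y (\<gamma> 0))) \<or>
      (\<forall>q\<in>topspace X. \<omega> (\<gamma> 0) (Y (\<gamma> 0)) \<le> \<omega> q (Y q))"
begin

definition m :: real where "m = \<omega> (\<gamma> 0) (Y (\<gamma> 0))"

lemma form_loop: "\<omega> (loop s) (Y (loop s)) = m"
  unfolding m_def loop_def by (rule form_const)

lemma m_neg: "m < 0"
  unfolding m_def by (rule negative[OF orbit_in_topspace])

text \<open>The chart-free counterpart of \<open>boundary_term\<close>, with \<open>V\<close> the
  variation field; values found in different charts therefore match when intervals are joined.
  \<open>periodize\<close> identifies the ends 0 and 1.\<close>

definition boundary :: "(real \<Rightarrow> real \<Rightarrow> 'a) \<Rightarrow> real \<Rightarrow> real" where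
  "boundary H s = (let V = velocity A (\<lambda>r. periodize (H r) s) 0 (at 0) in
     T * \<kappa> / m\<^sup>2 * g (periodize loop s) (Y (periodize loop s)) V - T * \<kappa>\<^sup>2 / (2 * m ^ 3) * \<omega> (periodize loop s) V)"

definition energy_density :: "(real \<Rightarrow> real \<Rightarrow> 'a) \<Rightarrow> real \<Rightarrow> real \<Rightarrow> real" where
  "energy_density H r s = (kropina g \<omega> (H r s) (right_velocity A (H r) s))\<^sup>2"

text \<open>\<open>first_variation\<close> is applied in a single chart around
  \<open>(0, x)\<close>. The point \<open>x\<close> may be an end of the cell, and then only
  intervals on one side of it are concerned.\<close>

lemma local_variation:
  assumes var: "variation X A \<omega> loop e H" and p: "0 \<le> p" "p < q" "q \<le> 1"
    and smooth: "smooth_into A ({-e<..<e} \<times> {p..q}) (\<lambda>(r, s). H r s)" and x: "x \<in> {p..q}"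
  obtains \<delta> where "\<delta> > 0"
    "\<And>a b. p \<le> a \<Longrightarrow> a < b \<Longrightarrow> b \<le> q \<Longrightarrow> x - \<delta> < a \<Longrightarrow> b < x + \<delta> \<Longrightarrow>
        has_integral_derivative (energy_density H) (boundary H) a b"
proof -
  have e: "e > 0" and H0: "\<And>s. s \<in> {0..1} \<Longrightarrow> H 0 s = loop s"
    and HO: "\<And>r. r \<in> {-e<..<e} \<Longrightarrow> H r \<in> Omega X A \<omega>"
    using var by (auto simp: variation_def)
  have Hper: "periodize (H r) s = H r s" if "r \<in> {-e<..<e}" "s \<in> {0..1}" for r s
    using HO[OF that(1)] that(2) by (intro periodize_eq) (auto simp: Omega_def)
  have "(0, x) \<in> {-e<..<e} \<times> {p..q}" using x e by simp
  then obtain c W h where c: "c \<in> A" and W: "open W" "(0, x) \<in> W" and sm: "smooth_on W h"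
    and h: "\<And>r s. (r, s) \<in> W \<Longrightarrow> r \<in> {-e<..<e} \<Longrightarrow> s \<in> {p..q} \<Longrightarrow> H r s \<in> fst c \<and> snd c (H r s) = h (r, s)"
    using smooth unfolding smooth_into_def by (smt (verit, best) IntI SigmaI case_prod_conv)
  let ?U = "snd c ` fst c"
  interpret killing_chart ?U "local_metric c" "local_form c" "local_field c" \<kappa>
    by (rule killing_chart[OF c])
  have h2: "Ck_on (Suc (Suc 0)) h W"
    using sm by (simp only: smooth_on_def)
  let ?ds = "partial (0, 1) h" and ?dr = "partial (1, 0) h"
  have loop_h: "loop s \<in> fst c" "snd c (loop s) = h (0, s)" if "s \<in> {p..q}" "(0, s) \<in> W" for s
    using h[OF that(2) _ that(1)] H0[of s] that p e by auto
  have chart_loop: "chart_inv c (h (0, s)) = loop s" "h (0, s) \<in> ?U" "c \<in> charts_at A (loop s)"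
    if "s \<in> {p..q}" "(0, s) \<in> W" for s
    using loop_h[OF that] c by (auto simp: charts_at_def simp flip: loop_h(2)[OF that])
  \<comment> \<open>The map \<open>h\<close> represents \<open>H\<close> only for \<open>s\<close>
    in \<open>{p..q}\<close>, so its derivative is compared with that of \<open>loop\<close> within
    this interval, one-sidedly at the ends.\<close>
  have flow: "?ds (0, s) = T *\<^sub>R local_field c (h (0, s))" if s: "s \<in> {p..q}" "(0, s) \<in> W" for s
  proof -
    obtain d where d: "d > 0" "{0-d..0+d} \<times> {s-d..s+d} \<subseteq> W"
      using open_contains_rectangle[OF W(1) s(2)] by blast
    have "((\<lambda>\<tau>. snd c (loop \<tau>)) has_vector_derivative T *\<^sub>R Y (loop s) c) (at s within {p..q})"
      by (rule loop_derivative[OF chart_loop(3)[OF s]])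
    then have "((\<lambda>\<tau>. h (0, \<tau>)) has_vector_derivative T *\<^sub>R Y (loop s) c) (at s within {p..q})"
    proof (rule has_vector_derivative_transform_within[OF _ d(1) s(1)])
      fix \<tau> assume "\<tau> \<in> {p..q}" "dist \<tau> s < d"
      then show "snd c (loop \<tau>) = h (0, \<tau>)"
        using d by (intro loop_h(2)) (auto simp: dist_real_def intro!: subsetD[OF d(2)])
    qed
    then have "?ds (0, s) = T *\<^sub>R Y (loop s) c"
      using has_vector_derivative_partial(2)[OF h2 s(2)] p(2) s(1)
      by (intro vector_derivative_unique_within_closed_interval[of p q s]) auto
    then show ?thesis by (simp add: local_field_def chart_loop(1)[OF s])
  qed
  have form_h: "local_form c (h (0, s)) (local_field c (h (0, s))) = m" if s: "s \<in> {p..q}" "(0, s) \<in> W" for s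
    using chart_loop[OF s] by (simp add: local_form_field[OF c] form_loop)
  \<comment> \<open>Outside the cell \<open>h\<close> is merely some smooth extension. The domain is
    shrunk so that on a full rectangle its values stay in the chart image and the denominator is
    nonzero; at \<open>(0, x)\<close> the denominator is \<open>T * m\<close>.\<close>
  define W1 where "W1 = W \<inter> h -` ?U"
  have cont: "continuous_on W h" "continuous_on W ?ds"
    using Ck_on_SucD[OF Ck_on_SucD[OF h2]] Ck_on_SucD[OF Ck_on_partial[OF h2]] by simp_all
  then have W1: "open W1"
    using W(1) open_chart[OF c] by (simp add: W1_def continuous_on_open_vimage Int_commute)
  have "continuous_on W1 (\<lambda>z. local_form c (h z) (?ds z))"
    by (rule O.continuous) (use cont in \<open>auto simp: W1_def intro: continuous_on_subset\<close>)
  then have "open (W1 \<inter> (\<lambda>z. local_form c (h z) (?ds z)) -` (- {0}))"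
    using W1 by (simp add: continuous_on_open_vimage Int_commute open_Compl)
  moreover have "(0, x) \<in> W1 \<inter> (\<lambda>z. local_form c (h z) (?ds z)) -` (- {0})"
    using chart_loop[OF x W(2)] W(2) form_h[OF x W(2)] T_pos m_neg
      linear_scale[OF local_form_linear[OF c chart_loop(2)[OF x W(2)]]]
    by (simp add: W1_def flow[OF x W(2)])
  ultimately obtain \<delta>0 where \<delta>0: "\<delta>0 > 0"
      "{0-\<delta>0..0+\<delta>0} \<times> {x-\<delta>0..x+\<delta>0} \<subseteq> W1 \<inter> (\<lambda>z. local_form c (h z) (?ds z)) -` (- {0})"
    by (rule open_contains_rectangle)
  \<comment> \<open>The bound \<open>e / 2\<close> puts the closed interval
    \<open>{-\<delta>..\<delta>}\<close> inside the open interval of parameters.\<close>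
  define \<delta> where "\<delta> = min \<delta>0 (e / 2)"
  have \<delta>: "\<delta> > 0" "\<delta> < e" "\<delta> \<le> \<delta>0" using \<delta>0(1) e by (auto simp: \<delta>_def)
  show ?thesis
  proof (rule that[OF \<delta>(1)])
    fix a b assume ab: "p \<le> a" "a < b" "b \<le> q" "x - \<delta> < a" "b < x + \<delta>"
    have "{-\<delta>..\<delta>} \<times> {a..b} \<subseteq> {0-\<delta>0..0+\<delta>0} \<times> {x-\<delta>0..x+\<delta>0}"
      using ab \<delta> by auto
    note box0 = subset_trans[OF this \<delta>0(2)]
    have box: "{-\<delta>..\<delta>} \<times> {a..b} \<subseteq> W"
      and hU: "\<And>z. z \<in> {-\<delta>..\<delta>} \<times> {a..b} \<Longrightarrow> h z \<in> ?U"
      and nz: "\<And>z. z \<in> {-\<delta>..\<delta>} \<times> {a..b} \<Longrightarrow> local_form c (h z) (?ds z) \<noteq> 0"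
      using box0 by (auto simp: W1_def)
    have s0: "s \<in> {p..q} \<and> (0, s) \<in> W" if "s \<in> {a..b}" for s
      using that ab box \<delta> by auto
    define F where "F = (\<lambda>r s. (local_metric c (h (r, s)) (?ds (r, s)) (?ds (r, s)) /
        (2 * local_form c (h (r, s)) (?ds (r, s))))\<^sup>2)"
    \<comment> \<open>Extremality is assumed at \<open>\<gamma> 0\<close> only; since
      \<open>\<omega>(Y)\<close> equals \<open>m\<close> along the whole orbit, it holds at every
      point of it.\<close>
    have crit: "frechet_derivative (\<lambda>p. local_form c p (local_field c (h (0, s)))) (at (h (0, s))) v
             + local_form c (h (0, s)) (frechet_derivative (local_field c) (at (h (0, s))) v) = 0"
      if s: "s \<in> {a..b}" for s v
    proof (rule extremum_imp_critical)
      show "h (0, s) \<in> ?U" using chart_loop(2) s0[OF s] by blast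
      have "chart_inv c z \<in> topspace X" if "z \<in> ?U" for z
        using chart_inv_in[OF that] chart_subset[OF c] by blast
      then show "(\<forall>p\<in>?U. local_form c p (local_field c p) \<le> local_form c (h (0, s)) (local_field c (h (0, s)))) \<or>
          (\<forall>p\<in>?U. local_form c (h (0, s)) (local_field c (h (0, s))) \<le> local_form c p (local_field c p))"
        using extremal form_h s0[OF s] by (simp add: local_form_field[OF c] m_def) blast
    qed
    have flow': "\<And>s. s \<in> {a..b} \<Longrightarrow> ?ds (0, s) = T *\<^sub>R local_field c (h (0, s))"
      and form': "\<And>s. s \<in> {a..b} \<Longrightarrow> local_form c (h (0, s)) (local_field c (h (0, s))) = m"
      using flow form_h s0 by blast+
    note fv = first_variation[OF h2 box \<delta>(1) less_imp_le[OF ab(2)] hU flow' crit form' nz]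
    have F_int: "F r integrable_on {a..b}" if "r \<in> {-\<delta>..\<delta>}" for r
      unfolding F_def by (rule fv(1)) (use that in auto)
    have F_der: "((\<lambda>r. integral {a..b} (F r)) has_real_derivative
           boundary_term T m (h (0, b)) (?dr (0, b)) - boundary_term T m (h (0, a)) (?dr (0, a))) (at 0)"
      unfolding F_def by (rule fv(2)) auto
    have per: "periodize (H r) s = H r s" "H r s \<in> fst c" "snd c (H r s) = h (r, s)"
      if "r \<in> {-\<delta>..\<delta>}" "s \<in> {a..b}" for r s
      using Hper[of r s] h[of r s] subsetD[OF box, of "(r, s)"] \<delta>(2) p ab that by auto
    \<comment> \<open>The end \<open>b\<close> is left out: the right velocity there looks beyond
      \<open>{a..b}\<close>, possibly into the next cell. One point does not affect the
      integral.\<close>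
    have energy_density: "energy_density H r s = F r s" if r: "r \<in> {-\<delta>..\<delta>}" and s: "s \<in> {a..b} - {b}" for r s
    proof -
      have s': "s \<in> {a..b}" "s < b" using s by auto
      note Hs = per[OF r s'(1)]
      have "(r, s) \<in> W" using box r s' by auto
      then have "((\<lambda>\<tau>. h (r, \<tau>)) has_vector_derivative ?ds (r, s)) (at s within {s..b})"
        by (rule has_vector_derivative_partial[OF h2])
      then have "((\<lambda>\<tau>. snd c (periodize (H r) \<tau>)) has_vector_derivative ?ds (r, s)) (at s within {s..b})"
        by (rule has_vector_derivative_transform[rotated 2]) (use per r s' in auto)
      then have D: "((\<lambda>\<tau>. snd c (periodize (H r) \<tau>)) has_vector_derivative ?ds (r, s)) (at_right s)"
        by (simp add: at_within_Icc_at_right s'(2))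
      have "\<forall>\<^sub>F \<tau> in at_right s. periodize (H r) \<tau> \<in> fst c"
        using eventually_at_right_real[OF s'(2)] by eventually_elim (use per r s' in auto)
      from velocity_eq_coord_vec[OF _ D this]
      have "right_velocity A (H r) s = coord_vec A c (H r s) (?ds (r, s))"
        using Hs c by (simp add: right_velocity_def charts_at_def trivial_limit_at_right_real)
      moreover have "chart_inv c (h (r, s)) = H r s"
        using Hs(2) c by (simp flip: Hs(3))
      ultimately show ?thesis
        by (simp add: energy_density_def F_def kropina_def local_metric_def local_form_def)
    qed
    have boundary: "boundary H s = boundary_term T m (h (0, s)) (?dr (0, s))" if s: "s \<in> {a..b}" for s
    proof -
      have zero: "(0::real) \<in> {-\<delta>..\<delta>}" using \<delta>(1) by simp
      note cl = chart_loop[OF conjunct1[OF s0[OF s]] conjunct2[OF s0[OF s]]]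
      have H0s: "periodize (H 0) s = loop s"
        using per(1)[OF zero s] H0[of s] s ab p by simp
      have "((\<lambda>r. h (r, s)) has_vector_derivative ?dr (0, s)) (at 0)"
        by (rule has_vector_derivative_partial(1)[OF h2]) (use s0[OF s] in simp)
      then have D: "((\<lambda>r. snd c (periodize (H r) s)) has_vector_derivative ?dr (0, s)) (at 0)"
        by (rule has_vector_derivative_transform_within_open[where S="{-\<delta><..<\<delta>}"])
          (use per s \<delta>(1) in auto)
      have ev: "\<forall>\<^sub>F r in at 0. periodize (H r) s \<in> fst c"
      proof -
        have "\<forall>\<^sub>F r in at 0. r \<in> {-\<delta><..<\<delta>}"
          by (rule eventually_at_in_open') (use \<delta>(1) in auto)
        then show ?thesis by eventually_elim (use per s in auto)
      qed
      have "velocity A (\<lambda>r. periodize (H r) s) 0 (at 0) = coord_vec A c (loop s) (?dr (0, s))"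
        using velocity_eq_coord_vec[of c "\<lambda>r. periodize (H r) s" 0, OF _ D ev] cl(3) H0s by simp
      then show ?thesis
        by (simp add: boundary_def Let_def boundary_term_def periodize_loop local_metric_def local_form_def
            local_field_def cl(1) coord_vec_field[OF cl(3)])
    qed
    have ev: "\<forall>\<^sub>F r in nhds 0. r \<in> {-\<delta>..\<delta>}"
      using eventually_nhds_in_open[of "{-\<delta><..<\<delta>}" 0] \<delta> by (auto elim!: eventually_mono)
    have "\<forall>\<^sub>F r in nhds 0. energy_density H r integrable_on {a..b}"
      using ev by eventually_elim (rule integrable_spike_finite[of "{b}", OF _ energy_density F_int], auto)
    moreover have "\<forall>\<^sub>F r in nhds 0. integral {a..b} (F r) = integral {a..b} (energy_density H r)"
      using ev by eventually_elim (rule integral_spike[of "{b}", OF _ energy_density], auto)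
    ultimately show "has_integral_derivative (energy_density H) (boundary H) a b"
      using F_der ab by (auto simp: has_integral_derivative_def boundary DERIV_cong_ev[OF refl])
  qed
qed

lemma loop_geodesic: "closed_geodesic X A g \<omega> loop"
  unfolding closed_geodesic_def
proof (intro conjI allI impI)
  show "loop \<in> Omega X A \<omega>" by (rule loop_in_Omega)
  fix e H assume var: "variation X A \<omega> loop e H"
  then obtain P where P: "partition01 P"
    and smooth: "\<And>a b. adjacent P a b \<Longrightarrow> smooth_into A ({-e<..<e} \<times> {a..b}) (\<lambda>(r, s). H r s)"
    by (auto simp: variation_def)
  have adj: "0 \<le> p \<and> p < q \<and> q \<le> 1" if "adjacent P p q" for p q
    using that P by (auto simp: adjacent_def partition01_def)
  have "has_integral_derivative (energy_density H) (boundary H) 0 1"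
  proof (rule has_integral_derivative_local)
    fix x :: real assume x: "0 < x" "x \<le> 1"
    then obtain p q where pq: "adjacent P p q" "p < x" "x \<le> q"
      by (rule adjacent_left[OF P])
    then obtain \<delta> where "\<delta> > 0" "\<And>a b. p \<le> a \<Longrightarrow> a < b \<Longrightarrow> b \<le> q \<Longrightarrow> x - \<delta> < a \<Longrightarrow> b < x + \<delta> \<Longrightarrow>
        has_integral_derivative (energy_density H) (boundary H) a b"
      using local_variation[OF var _ _ _ smooth[OF pq(1)], of x] adj[OF pq(1)] by auto
    then show "\<exists>\<delta>>0. \<forall>c<x. 0 \<le> c \<longrightarrow> x - c < \<delta> \<longrightarrow> has_integral_derivative (energy_density H) (boundary H) c x"
      \<comment> \<open>An interval ending at \<open>x\<close> and shorter than \<open>x - p\<close>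
        stays in the cell.\<close>
      using pq by (intro exI[of _ "min \<delta> (x - p)"]) auto
  next
    fix x :: real assume x: "0 \<le> x" "x < 1"
    then obtain p q where pq: "adjacent P p q" "p \<le> x" "x < q"
      by (rule adjacent_right[OF P])
    then obtain \<delta> where "\<delta> > 0" "\<And>a b. p \<le> a \<Longrightarrow> a < b \<Longrightarrow> b \<le> q \<Longrightarrow> x - \<delta> < a \<Longrightarrow> b < x + \<delta> \<Longrightarrow>
        has_integral_derivative (energy_density H) (boundary H) a b"
      using local_variation[OF var _ _ _ smooth[OF pq(1)], of x] adj[OF pq(1)] by auto
    then show "\<exists>\<delta>>0. \<forall>d>x. d \<le> 1 \<longrightarrow> d - x < \<delta> \<longrightarrow> has_integral_derivative (energy_density H) (boundary H) x d"
      using pq by (intro exI[of _ "min \<delta> (q - x)"]) auto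
  qed simp
  \<comment> \<open>As \<open>frac 1 = 0\<close>, both sides are the same expression.\<close>
  moreover have "boundary H 1 = boundary H 0"
    by (simp add: boundary_def periodize_def)
  ultimately have "((\<lambda>r. integral {0..1} (energy_density H r)) has_real_derivative 0) (at 0)"
    by (simp add: has_integral_derivative_def)
  from DERIV_cmult[OF this, of "1 / 2"]
  show "((\<lambda>r. energy A g \<omega> (H r)) has_real_derivative 0) (at 0)"
    by (simp add: energy_def energy_density_def[abs_def])
qed

end


section \<open>Two geodesics\<close>

context manifold
begin

text \<open>Within one chart the curve has a negligible image, being a differentiable image of a
  subset of the line in dimension at least 2, whereas the chart image is open and nonempty.\<close>

lemma curve_misses_point:
  assumes dim: "DIM('e) \<ge> 2" and ne: "topspace X \<noteq> {}"
    and deriv: "\<And>t c. c \<in> charts_at A (\<gamma> t) \<Longrightarrow> (snd c \<circ> \<gamma>) differentiable (at t)"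
  obtains q where "q \<in> topspace X" "q \<notin> range (\<gamma> :: real \<Rightarrow> 'a)"
proof -
  obtain p c where c: "c \<in> charts_at A p"
    using ne charts_at_nonempty by blast
  then have cA: "c \<in> A" "p \<in> fst c" by (auto simp: charts_at_def)
  let ?S = "{t. \<gamma> t \<in> fst c}"
  have "(snd c \<circ> \<gamma>) differentiable_on ?S"
    using deriv[of c] cA(1) by (simp add: differentiable_on_def charts_at_def differentiable_at_withinI)
  then have "negligible ((snd c \<circ> \<gamma>) ` ?S)"
    by (rule negligible_differentiable_image_lowdim[rotated]) (use dim in simp)
  moreover have "\<not> negligible (snd c ` fst c)"
    using open_not_negligible[OF open_chart[OF cA(1)]] cA(2) by blast
  ultimately have "\<not> snd c ` fst c \<subseteq> (snd c \<circ> \<gamma>) ` ?S"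
    using negligible_subset by blast
  then obtain q where "q \<in> fst c" "snd c q \<notin> (snd c \<circ> \<gamma>) ` ?S" by blast
  then show ?thesis
    using chart_subset[OF cA(1)] by (intro that[of q]) auto
qed

end

text \<open>Any reparametrization, iterates included, runs through the same points, so a loop with a
  point off the orbit is excluded.\<close>

lemma (in closed_orbit) not_reparametrization:
  assumes "\<delta> 0 \<notin> range \<gamma>"
  shows "\<not> reparametrization loop \<delta>"
proof
  assume "reparametrization loop \<delta>"
  then obtain \<psi> where "periodize \<delta> 0 = periodize loop (\<psi> 0)"
    unfolding reparametrization_def by auto
  then have "\<delta> 0 = \<gamma> (T * \<psi> 0)"
    by (simp add: periodize_loop) (simp add: periodize_def loop_def)
  then show False using assms by blast
qed

theorem theorem5p8:
  fixes S :: "'a topology"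
    and A :: "('a, 'e::euclidean_space) chart set"
    and g\<^sub>0 :: "'a \<Rightarrow> ('a, 'e) tvec \<Rightarrow> ('a, 'e) tvec \<Rightarrow> real"
    and \<omega> :: "'a \<Rightarrow> ('a, 'e) tvec \<Rightarrow> real"
    and Y :: "'a \<Rightarrow> ('a, 'e) tvec"
  assumes "smooth_manifold S A" and "DIM('e) \<ge> 2"
    and "connected_space S" and "compact_space S"
    and "riemannian_metric S A g\<^sub>0"
    and "killing_field S A g\<^sub>0 Y"
    and "\<exists>p\<in>topspace S. Y p \<noteq> (\<lambda>c. 0)"
    and "periodic_field S A Y"
    and "(\<lambda>p. g\<^sub>0 p (Y p) (Y p)) constant_on topspace S"
    and "smooth_one_form S A \<omega>"
    and "\<forall>p\<in>topspace S. \<omega> p (Y p) < 0"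
    and "lie_invariant_form S A Y \<omega>"
  shows "\<exists>\<gamma>\<^sub>1 \<gamma>\<^sub>2. closed_geodesic S A g\<^sub>0 \<omega> \<gamma>\<^sub>1 \<and> \<not> \<gamma>\<^sub>1 constant_on {0..1} \<and>
                 closed_geodesic S A g\<^sub>0 \<omega> \<gamma>\<^sub>2 \<and> \<not> \<gamma>\<^sub>2 constant_on {0..1} \<and>
                 \<not> reparametrization \<gamma>\<^sub>1 \<gamma>\<^sub>2"
proof -
  obtain \<kappa> where \<kappa>: "\<And>p. p \<in> topspace S \<Longrightarrow> g\<^sub>0 p (Y p) (Y p) = \<kappa>"
    using assms(9) by (auto simp: constant_on_def)
  interpret killing_data S A g\<^sub>0 \<omega> Y \<kappa>
    using assms \<kappa> by unfold_locales auto
  define f where "f = (\<lambda>p. \<omega> p (Y p))"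
  have "compact (f ` topspace S)"
    using image_compactin[OF _ continuous_form_field, of "topspace S"] \<open>compact_space S\<close>
    by (simp add: compact_space_def f_def)
  moreover have ne: "topspace S \<noteq> {}" using assms(7) by blast
  ultimately obtain p q where p: "p \<in> topspace S" "\<And>x. x \<in> topspace S \<Longrightarrow> f x \<le> f p"
    and q: "q \<in> topspace S" "\<And>x. x \<in> topspace S \<Longrightarrow> f q \<le> f x"
    using compact_attains_sup[of "f ` topspace S"] compact_attains_inf[of "f ` topspace S"] by auto
  have orbit: "\<exists>\<gamma> T. closed_orbit S A g\<^sub>0 \<omega> Y \<kappa> \<gamma> T \<and> \<gamma> 0 = x" if x: "x \<in> topspace S" for x
  proof -
    obtain \<gamma> T where "integral_curve A Y \<gamma>" "\<gamma> 0 = x" "T > 0" "\<And>t. \<gamma> (t + T) = \<gamma> t"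
      using assms(8) x unfolding periodic_field_def by blast
    then show ?thesis
      using killing_data_axioms by (blast intro: closed_orbit.intro closed_orbit_axioms.intro)
  qed
  obtain \<gamma> T where "closed_orbit S A g\<^sub>0 \<omega> Y \<kappa> \<gamma> T" and \<gamma>0: "\<gamma> 0 = p"
    using orbit[OF p(1)] by blast
  then interpret P: closed_orbit S A g\<^sub>0 \<omega> Y \<kappa> \<gamma> T by simp
  interpret P: extremal_orbit S A g\<^sub>0 \<omega> Y \<kappa> \<gamma> T
    by unfold_locales (use p in \<open>auto simp: \<gamma>0 f_def\<close>)
  \<comment> \<open>Either way \<open>q'\<close> is a minimum of \<open>f\<close> off the first
    orbit, which lets the second geodesic be treated uniformly.\<close>
  obtain q' where q': "q' \<in> topspace S" "\<And>x. x \<in> topspace S \<Longrightarrow> f q' \<le> f x" "q' \<notin> range \<gamma>"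
  proof (cases "f q = f p")
    case True
    have "(snd c \<circ> \<gamma>) differentiable (at t)" if "c \<in> charts_at A (\<gamma> t)" for c t
      using P.orbit_derivative[OF that] by (auto simp: o_def intro: differentiableI_vector)
    then obtain q' where "q' \<in> topspace S" "q' \<notin> range \<gamma>"
      using curve_misses_point[OF assms(2) ne] by blast
    moreover have "f q' \<le> f x" if "x \<in> topspace S" for x
      using True p(2)[OF calculation(1)] q(2)[OF that] by simp
    ultimately show ?thesis using that by blast
  next
    case False
    have "f (\<gamma> t) = f p" for t
      using P.form_const[of t 0] by (simp add: \<gamma>0 f_def)
    with False have "q \<notin> range \<gamma>" by auto
    with q show ?thesis using that by blast
  qed
  obtain \<delta> U where "closed_orbit S A g\<^sub>0 \<omega> Y \<kappa> \<delta> U" and \<delta>0: "\<delta> 0 = q'"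
    using orbit[OF q'(1)] by blast
  then interpret Q: closed_orbit S A g\<^sub>0 \<omega> Y \<kappa> \<delta> U by simp
  interpret Q: extremal_orbit S A g\<^sub>0 \<omega> Y \<kappa> \<delta> U
    by unfold_locales (use q'(2) in \<open>auto simp: \<delta>0 f_def\<close>)
  have "Q.loop 0 \<notin> range \<gamma>"
    using q'(3) by (simp add: Q.loop_def \<delta>0)
  then show ?thesis
    using P.loop_geodesic P.loop_not_constant Q.loop_geodesic Q.loop_not_constant P.not_reparametrization
    by blast
qed

end
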